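(* Let $(\pi,V)$ be an irreducible admissible genuine supercuspidal representation of $\overline{S}$, let $\xi\in k(\pi)$, let $l^\xi$ be a nonzero $\psi^\xi$-Whittaker functional on $V$, let $v\in V$ and let $\mu$ be a character of $k^\times$. Then the integral $$Z(s,\mu,l^\xi,v)=2\int_{k^\times}l^\xi(\pi(\underline{x})v)\chi_\psi(x)\mu(x)|x|^{s-1/2}d^\times x$$ converges absolutely for every $s\in\mathbb{C}$, and $Z(s,\mu,l^\xi,v)$ is a polynomial in $q^s$ and $q^{-s}$.
   Context: Let $k$ be a non-archimedean local field of characteristic $0$ with ring of integers $O$, maximal ideal $P$, residue field of odd cardinality $q$, normalized absolute value $|\cdot|$. Fix a nontrivial additive character $\psi$ of $k$ trivial on $O$ and nontrivial on $P^{-1}$; $dx$ is the self-dual Haar measure, $d^\times x=dx/|x|$. Let $(a,b)$ be the Hilbert symbol. For $g=\begin{pmatrix}a&b\\c&d\end{pmatrix}\in S=\mathrm{SL}_2(k)$ put $\chi(g)=c$ if $c\ne0$, $\chi(g)=d$ if $c=0$, $\{g,h\}=(\chi(gh)/\chi(g),\chi(gh)/\chi(h))$. The metaplectic cover $\overline{S}$ is the set of $[g,\epsilon]$ with product $[g,\epsilon_1][h,\epsilon_2]=[gh,\{g,h\}\epsilon_1\epsilon_2]$; $n(x)=[\begin{pmatrix}1&x\\0&1\end{pmatrix},1]$, $\underline{x}=[\mathrm{diag}(x,x^{-1}),1]$. Weil constant $\alpha_\psi(a)$: $\int_k\hat\Phi(x)\psi(ax^2)dx=|a|^{-1/2}\alpha_\psi(a)\int_k\Phi(x)\psi(-a^{-1}x^2)dx$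 for all $\Phi\in C_c^\infty(k)$, with $\hat\Phi(y)=\int_k\Phi(x)\psi(-2yx)dx$; $\chi_\psi(a)=\alpha_\psi(1)/\alpha_\psi(a)$. Genuine: $\pi([1,-1])=-\mathrm{id}$. Supercuspidal: for each $v$ there is $n\in\mathbb{Z}$ with $\int_{P^n}\pi(n(x))v\,dx=0$. A $\psi^\xi$-Whittaker functional is a linear form $l$ with $l(\pi(n(a))v)=\psi(\xi a)l(v)$ ($a\in k$); $k(\pi)$ is the set of $\xi\in k^\times$ admitting a nonzero one. *)

theory Defs
  imports "HOL-Analysis.Analysis" "HOL-Algebra.Group"
begin

class nonarch_valued_field = field + metric_space +
  fixes nabs :: "'a \<Rightarrow> real"
  assumes dist_nabs: "dist x y = nabs (x - y)"
    and nabs_mult: "nabs (x * y) = nabs x * nabs y"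
    and nabs_add_le: "nabs (x + y) \<le> max (nabs x) (nabs y)"
begin

definition valuation_ring :: "'a set"
  where "valuation_ring = {x. nabs x \<le> 1}"

definition maximal_ideal :: "'a set"
  where "maximal_ideal = {x. nabs x < 1}"

definition residue_field :: "'a set set"
  where "residue_field = valuation_ring //
    {(x, y). x \<in> valuation_ring \<and> y \<in> valuation_ring \<and> x - y \<in> maximal_ideal}"

end

text \<open>The last two axioms say that the value group is generated by \<open>1/q\<close>, where \<open>q\<close> is
  the cardinality of the residue field: the valuation is discrete, and the absolute value
  (hence also the metric) is the normalized one.\<close>

class nonarch_local_field_char_0 = nonarch_valued_field + complete_space + field_char_0 +
  assumes finite_residue_field: "finite residue_field"
    and nabs_uniformizer: "\<exists>w. nabs w = 1 / real (card residue_field)"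
    and nabs_value_group: "x \<noteq> 0 \<Longrightarrow> \<exists>n::int. nabs x = real (card residue_field) powi n"

definition residue_card :: "'k::nonarch_local_field_char_0 itself \<Rightarrow> nat"
  where "residue_card T = card (residue_field :: 'k set set)"

definition ideal_power :: "int \<Rightarrow> 'k::nonarch_local_field_char_0 set"
  where "ideal_power n = {x. nabs x \<le> real (residue_card TYPE('k)) powi (- n)}"


subsection \<open>Characters, Haar measure, Fourier transform\<close>

definition additive_character :: "('k::nonarch_local_field_char_0 \<Rightarrow> complex) \<Rightarrow> bool"
  where "additive_character \<psi> \<longleftrightarrow> continuous_on UNIV \<psi> \<and>
    (\<forall>x y. \<psi> (x + y) = \<psi> x * \<psi> y) \<and> (\<forall>x. norm (\<psi> x) = 1)"

text \<open>Not required to be unitary.\<close>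

definition mult_character :: "('k::nonarch_local_field_char_0 \<Rightarrow> complex) \<Rightarrow> bool"
  where "mult_character \<mu> \<longleftrightarrow> continuous_on (- {0}) \<mu> \<and>
    (\<forall>x y. x \<noteq> 0 \<longrightarrow> y \<noteq> 0 \<longrightarrow> \<mu> (x * y) = \<mu> x * \<mu> y) \<and> (\<forall>x. x \<noteq> 0 \<longrightarrow> \<mu> x \<noteq> 0)"

text \<open>Regularity is automatic, the field being locally compact and second countable.\<close>

definition haar_measure :: "'k::nonarch_local_field_char_0 measure \<Rightarrow> bool"
  where "haar_measure dx \<longleftrightarrow> sets dx = sets borel \<and> emeasure dx UNIV \<noteq> 0 \<and>
    (\<forall>K. compact K \<longrightarrow> emeasure dx K < \<infinity>) \<and>
    (\<forall>a. \<forall>A\<in>sets borel. emeasure dx ((+) a ` A) = emeasure dx A)"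

definition schwartz_bruhat :: "('k::nonarch_local_field_char_0 \<Rightarrow> complex) set"
  where "schwartz_bruhat = {\<Phi>. (\<forall>x. \<exists>U. open U \<and> x \<in> U \<and> \<Phi> constant_on U) \<and>
    (\<exists>K. compact K \<and> (\<forall>x. x \<notin> K \<longrightarrow> \<Phi> x = 0))}"

definition fourier ::
    "'k::nonarch_local_field_char_0 measure \<Rightarrow> ('k \<Rightarrow> complex) \<Rightarrow> ('k \<Rightarrow> complex) \<Rightarrow> 'k \<Rightarrow> complex"
  where "fourier dx \<psi> \<Phi> y = (LINT x|dx. \<Phi> x * \<psi> (y * x))"

definition self_dual_haar_measure ::
    "('k::nonarch_local_field_char_0 \<Rightarrow> complex) \<Rightarrow> 'k measure \<Rightarrow> bool"
  where "self_dual_haar_measure \<psi> dx \<longleftrightarrow> haar_measure dx \<and>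
    (\<forall>\<Phi>\<in>schwartz_bruhat. \<forall>x. fourier dx \<psi> (fourier dx \<psi> \<Phi>) x = \<Phi> (- x))"

text \<open>In \<open>HOL\<close> we have \<open>1 / 0 = 0\<close>, so the point \<open>0\<close> carries no mass.\<close>

definition mult_measure :: "'k::nonarch_local_field_char_0 measure \<Rightarrow> 'k measure"
  where "mult_measure dx = density dx (\<lambda>x. ennreal (1 / nabs x))"

definition weil_constant ::
    "'k::nonarch_local_field_char_0 measure \<Rightarrow> ('k \<Rightarrow> complex) \<Rightarrow> 'k \<Rightarrow> complex"
  where "weil_constant dx \<psi> a = (THE \<alpha>. \<forall>\<Phi>\<in>schwartz_bruhat.
    (LINT x|dx. fourier dx (\<lambda>t. \<psi> (- 2 * t)) \<Phi> x * \<psi> (a * x\<^sup>2)) =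
    of_real (nabs a powr (- 1 / 2)) * \<alpha> * (LINT x|dx. \<Phi> x * \<psi> (- inverse a * x\<^sup>2)))"

definition chi_weil ::
    "'k::nonarch_local_field_char_0 measure \<Rightarrow> ('k \<Rightarrow> complex) \<Rightarrow> 'k \<Rightarrow> complex"
  where "chi_weil dx \<psi> a = weil_constant dx \<psi> 1 / weil_constant dx \<psi> a"


subsection \<open>The metaplectic cover of \<open>SL\<^sub>2\<close>\<close>

definition hilbert_symbol :: "'k::field \<Rightarrow> 'k \<Rightarrow> int"
  where "hilbert_symbol a b =
    (if \<exists>x y z. (x, y, z) \<noteq> (0, 0, 0) \<and> z\<^sup>2 = a * x\<^sup>2 + b * y\<^sup>2 then 1 else - 1)"

definition kubota_chi :: "'k::field^2^2 \<Rightarrow> 'k"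
  where "kubota_chi g = (if g$2$1 \<noteq> 0 then g$2$1 else g$2$2)"

definition kubota_cocycle :: "'k::field^2^2 \<Rightarrow> 'k^2^2 \<Rightarrow> int"
  where "kubota_cocycle g h = hilbert_symbol
    (kubota_chi (g ** h) / kubota_chi g) (kubota_chi (g ** h) / kubota_chi h)"

definition Mp :: "(('k::field^2^2) \<times> int) monoid"
  where "Mp = \<lparr>carrier = {g. det g = 1} \<times> {1, - 1},
    mult = (\<lambda>(g, e1) (h, e2). (g ** h, kubota_cocycle g h * e1 * e2)),
    one = (mat 1, 1)\<rparr>"

definition mp_unip :: "'k::field \<Rightarrow> ('k^2^2) \<times> int"
  where "mp_unip x = (vector [vector [1, x], vector [0, 1]], 1)"

definition mp_diag :: "'k::field \<Rightarrow> ('k^2^2) \<times> int"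
  where "mp_diag x = (vector [vector [x, 0], vector [0, inverse x]], 1)"

definition congruence_subgroup :: "nat \<Rightarrow> ('k::nonarch_local_field_char_0^2^2) set"
  where "congruence_subgroup n =
    {g. det g = 1 \<and> (\<forall>i j. g$i$j - mat 1$i$j \<in> ideal_power (int n))}"

text \<open>The topology of the covering group is not the product topology: the cocycle is not
  continuous. In odd residue characteristic the units congruent to \<open>1\<close> are squares, so the cocycle
  is trivial on the principal congruence subgroups of level at least \<open>1\<close>. Their images under
  \<open>g \<mapsto> [g, 1]\<close> are thus subgroups, and they form a neighbourhood basis of the identity for the
  unique topology that makes \<open>Mp\<close> a topological double cover of \<open>SL\<^sub>2\<close>; open sets are
  obtained by translation.\<close>

definition mp_open :: "(('k::nonarch_local_field_char_0^2^2) \<times> int) set \<Rightarrow> bool"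
  where "mp_open U \<longleftrightarrow> U \<subseteq> carrier Mp \<and>
    (\<forall>u\<in>U. \<exists>n\<ge>1. \<forall>g\<in>congruence_subgroup n. u \<otimes>\<^bsub>Mp\<^esub> (g, 1) \<in> U)"

definition mp_topology :: "(('k::nonarch_local_field_char_0^2^2) \<times> int) topology"
  where "mp_topology = topology mp_open"

lemma residue_card_ge_1: "residue_card TYPE('k::nonarch_local_field_char_0) \<ge> 1"
proof -
  have "(0::'k) \<in> valuation_ring"
    using dist_nabs[of "0::'k" 0] by (simp add: valuation_ring_def)
  then have "(residue_field :: 'k set set) \<noteq> {}"
    by (auto simp: residue_field_def quotient_def)
  then show ?thesis
    using finite_residue_field by (simp add: residue_card_def Suc_le_eq card_gt_0_iff)
qed

lemma ideal_power_antimono: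
  assumes "m \<le> n"
  shows "(ideal_power n :: 'k::nonarch_local_field_char_0 set) \<subseteq> ideal_power m"
proof -
  have "real (residue_card TYPE('k)) powi (- n) \<le> real (residue_card TYPE('k)) powi (- m)"
    using assms residue_card_ge_1[where 'k = 'k] by (intro power_int_increasing) auto
  then show ?thesis
    by (auto simp: ideal_power_def)
qed

lemma congruence_subgroup_antimono:
  "m \<le> n \<Longrightarrow> congruence_subgroup n \<subseteq> congruence_subgroup m"
  using ideal_power_antimono[of "int m" "int n"] by (auto simp: congruence_subgroup_def)

lemma istopology_mp_open:
  "istopology (mp_open :: (('k::nonarch_local_field_char_0^2^2) \<times> int) set \<Rightarrow> bool)"
proof -
  have "mp_open (S \<inter> T)" if S: "mp_open S" and T: "mp_open T" for S T :: "(('k^2^2) \<times> int) set"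
    unfolding mp_open_def
  proof (intro conjI ballI)
    show "S \<inter> T \<subseteq> carrier Mp"
      using S by (auto simp: mp_open_def)
    fix u assume u: "u \<in> S \<inter> T"
    obtain m where m: "m \<ge> 1" "\<forall>g\<in>congruence_subgroup m. u \<otimes>\<^bsub>Mp\<^esub> (g, 1) \<in> S"
      using S u unfolding mp_open_def by blast
    obtain n where n: "n \<ge> 1" "\<forall>g\<in>congruence_subgroup n. u \<otimes>\<^bsub>Mp\<^esub> (g, 1) \<in> T"
      using T u unfolding mp_open_def by blast
    show "\<exists>n\<ge>1. \<forall>g\<in>congruence_subgroup n. u \<otimes>\<^bsub>Mp\<^esub> (g, 1) \<in> S \<inter> T"
    proof (intro exI conjI ballI)
      show "max m n \<ge> 1"
        using m(1) by simp
      fix g :: "'k^2^2" assume g: "g \<in> congruence_subgroup (max m n)"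
      have "g \<in> congruence_subgroup m" "g \<in> congruence_subgroup n"
        using g congruence_subgroup_antimono[of m "max m n"]
          congruence_subgroup_antimono[of n "max m n"] by auto
      then show "u \<otimes>\<^bsub>Mp\<^esub> (g, 1) \<in> S \<inter> T"
        using m(2) n(2) by blast
    qed
  qed
  moreover have "mp_open (\<Union>\<K>)" if "\<forall>K\<in>\<K>. mp_open K" for \<K> :: "(('k^2^2) \<times> int) set set"
    using that unfolding mp_open_def by (meson Sup_least UnionE UnionI)
  ultimately show ?thesis
    unfolding istopology_def by blast
qed

lemma openin_mp_topology: "openin mp_topology U \<longleftrightarrow> mp_open U"
  by (simp add: mp_topology_def istopology_mp_open topology_inverse')


subsection \<open>Representations of the metaplectic cover\<close>

text \<open>The underlying space is the whole type \<open>'v\<close>, with complex scalar multiplication \<open>smul\<close>.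
  Values of \<open>\<pi>\<close> outside the carrier of \<open>Mp\<close> are irrelevant.\<close>

definition mp_rep :: "(complex \<Rightarrow> 'v::ab_group_add \<Rightarrow> 'v) \<Rightarrow>
    (('k::nonarch_local_field_char_0^2^2) \<times> int \<Rightarrow> 'v \<Rightarrow> 'v) \<Rightarrow> bool"
  where "mp_rep smul \<pi> \<longleftrightarrow> vector_space smul \<and>
    (\<forall>g\<in>carrier Mp. Vector_Spaces.linear smul smul (\<pi> g)) \<and>
    (\<forall>g\<in>carrier Mp. \<forall>h\<in>carrier Mp. \<pi> (g \<otimes>\<^bsub>Mp\<^esub> h) = \<pi> g \<circ> \<pi> h) \<and> \<pi> \<one>\<^bsub>Mp\<^esub> = id"

definition mp_irreducible :: "(complex \<Rightarrow> 'v::ab_group_add \<Rightarrow> 'v) \<Rightarrow>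
    (('k::nonarch_local_field_char_0^2^2) \<times> int \<Rightarrow> 'v \<Rightarrow> 'v) \<Rightarrow> bool"
  where "mp_irreducible smul \<pi> \<longleftrightarrow> (\<exists>v::'v. v \<noteq> 0) \<and>
    (\<forall>W. module.subspace smul W \<and> (\<forall>g\<in>carrier Mp. \<pi> g ` W \<subseteq> W) \<longrightarrow> W = {0} \<or> W = UNIV)"

definition mp_smooth ::
    "(('k::nonarch_local_field_char_0^2^2) \<times> int \<Rightarrow> 'v \<Rightarrow> 'v) \<Rightarrow> bool"
  where "mp_smooth \<pi> \<longleftrightarrow> (\<forall>v. openin mp_topology {g \<in> carrier Mp. \<pi> g v = v})"

definition mp_admissible :: "(complex \<Rightarrow> 'v::ab_group_add \<Rightarrow> 'v) \<Rightarrow>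
    (('k::nonarch_local_field_char_0^2^2) \<times> int \<Rightarrow> 'v \<Rightarrow> 'v) \<Rightarrow> bool"
  where "mp_admissible smul \<pi> \<longleftrightarrow> mp_smooth \<pi> \<and>
    (\<forall>K. subgroup K Mp \<and> openin mp_topology K \<and> compactin mp_topology K \<longrightarrow>
      (\<exists>B. finite B \<and> {v. \<forall>g\<in>K. \<pi> g v = v} \<subseteq> module.span smul B))"

definition mp_genuine ::
    "(('k::nonarch_local_field_char_0^2^2) \<times> int \<Rightarrow> 'v::ab_group_add \<Rightarrow> 'v) \<Rightarrow> bool"
  where "mp_genuine \<pi> \<longleftrightarrow> (\<forall>v. \<pi> (mat 1, - 1) v = - v)"

text \<open>Integral over \<open>A\<close> of a function with values in a complex vector space that has no topology,
  for functions taking finitely many values on \<open>A\<close>, in particular locally constant functions on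
  compact sets.\<close>

definition step_integral ::
    "(complex \<Rightarrow> 'v::ab_group_add \<Rightarrow> 'v) \<Rightarrow> 'a measure \<Rightarrow> 'a set \<Rightarrow> ('a \<Rightarrow> 'v) \<Rightarrow> 'v"
  where "step_integral smul M A f =
    (\<Sum>w\<in>f ` A. smul (of_real (measure M {x \<in> A. f x = w})) w)"

text \<open>For smooth \<open>\<pi>\<close> the integrand below is locally constant, and the fractional ideals are
  compact.\<close>

definition mp_supercuspidal :: "'k::nonarch_local_field_char_0 measure \<Rightarrow>
    (complex \<Rightarrow> 'v::ab_group_add \<Rightarrow> 'v) \<Rightarrow> (('k^2^2) \<times> int \<Rightarrow> 'v \<Rightarrow> 'v) \<Rightarrow> bool"
  where "mp_supercuspidal dx smul \<pi> \<longleftrightarrow>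
    (\<forall>v. \<exists>n::int. step_integral smul dx (ideal_power n) (\<lambda>x. \<pi> (mp_unip x) v) = 0)"

definition whittaker_functional :: "('k::nonarch_local_field_char_0 \<Rightarrow> complex) \<Rightarrow>
    (complex \<Rightarrow> 'v::ab_group_add \<Rightarrow> 'v) \<Rightarrow> (('k^2^2) \<times> int \<Rightarrow> 'v \<Rightarrow> 'v) \<Rightarrow>
    'k \<Rightarrow> ('v \<Rightarrow> complex) \<Rightarrow> bool"
  where "whittaker_functional \<psi> smul \<pi> \<xi> l \<longleftrightarrow> Vector_Spaces.linear smul (*) l \<and>
    (\<forall>a v. l (\<pi> (mp_unip a) v) = \<psi> (\<xi> * a) * l v)"

definition whittaker_support :: "('k::nonarch_local_field_char_0 \<Rightarrow> complex) \<Rightarrow>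
    (complex \<Rightarrow> 'v::ab_group_add \<Rightarrow> 'v) \<Rightarrow> (('k^2^2) \<times> int \<Rightarrow> 'v \<Rightarrow> 'v) \<Rightarrow> 'k set"
  where "whittaker_support \<psi> smul \<pi> =
    {\<xi>. \<xi> \<noteq> 0 \<and> (\<exists>l. whittaker_functional \<psi> smul \<pi> \<xi> l \<and> (\<exists>v. l v \<noteq> 0))}"

definition zeta_integrand :: "'k::nonarch_local_field_char_0 measure \<Rightarrow> ('k \<Rightarrow> complex) \<Rightarrow>
    (('k^2^2) \<times> int \<Rightarrow> 'v \<Rightarrow> 'v) \<Rightarrow> complex \<Rightarrow> ('k \<Rightarrow> complex) \<Rightarrow> ('v \<Rightarrow> complex) \<Rightarrow> 'v \<Rightarrow>
    'k \<Rightarrow> complex"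
  where "zeta_integrand dx \<psi> \<pi> s \<mu> l v x =
    l (\<pi> (mp_diag x) v) * chi_weil dx \<psi> x * \<mu> x * of_real (nabs x) powr (s - 1 / 2)"

definition zeta_integral :: "'k::nonarch_local_field_char_0 measure \<Rightarrow> ('k \<Rightarrow> complex) \<Rightarrow>
    (('k^2^2) \<times> int \<Rightarrow> 'v \<Rightarrow> 'v) \<Rightarrow> complex \<Rightarrow> ('k \<Rightarrow> complex) \<Rightarrow> ('v \<Rightarrow> complex) \<Rightarrow> 'v \<Rightarrow>
    complex"
  where "zeta_integral dx \<psi> \<pi> s \<mu> l v =
    2 * (LINT x : - {0}|mult_measure dx. zeta_integrand dx \<psi> \<pi> s \<mu> l v x)"

end

theory Submission
  imports Defs
begin

text \<open>Put \<open>f(x) = l(\<pi>(diag(x, 1/x)) v)\<close>. Moving a unipotent \<open>n(a)\<close> through the torus gives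
  \<open>l(\<pi>(diag(x, 1/x)) \<pi>(n(a)) v) = \<psi>(\<xi> x\<^sup>2 a) f(x)\<close>. As \<open>v\<close> is fixed by \<open>n(a)\<close> for small \<open>a\<close>, the
  nontriviality of \<open>\<psi>\<close> forces \<open>f(x) = 0\<close> for large \<open>|x|\<close>. Integrating over the ideal supplied by
  supercuspidality, on which \<open>\<psi>(\<xi> x\<^sup>2 a) = 1\<close> when \<open>|x|\<close> is small, forces \<open>f(x) = 0\<close> for small
  \<open>|x|\<close>. Small elements of \<open>1 + P\<close> are squares of units \<open>t\<close>; they fix \<open>v\<close>, have trivial Hilbert
  symbol, and do not change the Weil factor, so \<open>f \<chi>\<^sub>\<psi>\<close> is locally constant. The integrand is thus
  continuous and supported on finitely many shells \<open>|x| = q\<^sup>k\<close>, each of which contributes a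
  constant multiple of \<open>(q\<^sup>s)\<^sup>k\<close>.\<close>

subsection \<open>The absolute value\<close>

lemma nabs_zero [simp]: "nabs (0::'k::nonarch_valued_field) = 0"
  using dist_nabs[of "0::'k" 0] by simp

lemma nabs_nonneg [simp]: "nabs (x::'k::nonarch_valued_field) \<ge> 0"
  using dist_nabs[of x 0] by (metis diff_zero zero_le_dist)

lemma nabs_eq_0_iff [simp]: "nabs (x::'k::nonarch_valued_field) = 0 \<longleftrightarrow> x = 0"
  using dist_nabs[of x 0] by (metis diff_zero dist_eq_0_iff)

lemma nabs_pos_iff [simp]: "nabs (x::'k::nonarch_valued_field) > 0 \<longleftrightarrow> x \<noteq> 0"
  using nabs_nonneg[of x] nabs_eq_0_iff[of x] by linarith

lemma nabs_one [simp]: "nabs (1::'k::nonarch_valued_field) = 1"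
  using nabs_mult[of "1::'k" 1] by simp

lemma nabs_minus [simp]: "nabs (- x::'k::nonarch_valued_field) = nabs x"
  by (metis diff_0 diff_zero dist_commute dist_nabs)

lemma nabs_inverse: "nabs (inverse x::'k::nonarch_valued_field) = inverse (nabs x)"
proof (cases "x = 0")
  case False
  then show ?thesis
    using nabs_mult[of x "inverse x"] by (simp add: field_simps)
qed simp

lemma nabs_divide: "nabs (x / y::'k::nonarch_valued_field) = nabs x / nabs y"
  by (simp add: divide_inverse nabs_mult nabs_inverse)

lemma nabs_power: "nabs (x ^ n::'k::nonarch_valued_field) = nabs x ^ n"
  by (induction n) (auto simp: nabs_mult)

lemma nabs_power_int: "nabs (x powi n::'k::nonarch_valued_field) = nabs x powi n"
  by (simp add: power_int_def nabs_power nabs_inverse)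

lemma nabs_diff_le: "nabs (x - y::'k::nonarch_valued_field) \<le> max (nabs x) (nabs y)"
  using nabs_add_le[of x "- y"] by simp

text \<open>The ultrametric inequality bounds \<open>nabs (1 + z)\<close> above by \<open>1\<close>;
  applied to \<open>1 = (1 + z) - z\<close> with \<open>nabs z < 1\<close> it gives the reverse
  bound.\<close>

lemma nabs_one_plus:
  assumes "nabs (z::'k::nonarch_valued_field) < 1"
  shows "nabs (1 + z) = 1"
  using assms nabs_add_le[of 1 z] nabs_diff_le[of "1 + z" z] by auto

section \<open>Residue cardinality and value group\<close>

lemma residue_card_ge_2: "residue_card TYPE('k::nonarch_local_field_char_0) \<ge> 2"
proof -
  let ?R = "{(x, y). x \<in> (valuation_ring :: 'k set) \<and> y \<in> valuation_ring \<and> x - y \<in> maximal_ideal}"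
  have sub: "{?R `` {0}, ?R `` {1}} \<subseteq> (residue_field :: 'k set set)"
    unfolding residue_field_def by (intro insert_subsetI empty_subsetI quotientI)
      (simp_all add: valuation_ring_def)
  have "1 \<in> ?R `` {1}" "1 \<notin> ?R `` {0}"
    by (auto simp: valuation_ring_def maximal_ideal_def)
  then have "?R `` {0} \<noteq> ?R `` {1}"
    by blast
  then have "card {?R `` {0}, ?R `` {1}} = 2"
    by (rule card_2_iff[THEN iffD2, OF exI, OF exI, OF conjI, OF refl])
  then show ?thesis
    using card_mono[OF finite_residue_field sub] unfolding residue_card_def by (simp only:)
qed

lemma nabs_value:
  assumes "(x::'k::nonarch_local_field_char_0) \<noteq> 0"
  obtains n where "nabs x = real (residue_card TYPE('k)) powi n"
  using nabs_value_group[OF assms] by (auto simp: residue_card_def)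

lemma exists_nabs_eq:
  "\<exists>w::'k::nonarch_local_field_char_0. nabs w = real (residue_card TYPE('k)) powi n"
proof -
  obtain w :: 'k where w: "nabs w = 1 / real (residue_card TYPE('k))"
    using nabs_uniformizer by (auto simp: residue_card_def)
  have "nabs (w powi (- n)) = real (residue_card TYPE('k)) powi n"
    by (simp add: nabs_power_int nabs_inverse w power_int_minus power_int_divide_distrib)
  then show ?thesis ..
qed

lemma exists_residue_power_ge:
  "\<exists>n::nat. real (residue_card TYPE('k::nonarch_local_field_char_0)) ^ n \<ge> r"
  using real_arch_pow[of "real (residue_card TYPE('k))" r] residue_card_ge_2[where 'k='k]
  by (auto intro: less_imp_le)

lemma exists_residue_power_le:
  assumes "r > 0"
  shows "\<exists>n::nat. real (residue_card TYPE('k::nonarch_local_field_char_0)) powi (- int n) \<le> r"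
proof -
  obtain n where "real (residue_card TYPE('k)) ^ n \<ge> 1 / r"
    using exists_residue_power_ge by blast
  then have "real (residue_card TYPE('k)) powi (- int n) \<le> r"
    using assms residue_card_ge_2[where 'k='k] by (simp add: power_int_minus field_simps)
  then show ?thesis ..
qed

text \<open>Multiplication by \<open>c\<close> scales every distance by exactly
  \<open>nabs c\<close>. The type class only puts a metric next to the field structure, so
  continuity has to come from \<open>dist_nabs\<close>.\<close>

lemma continuous_on_nabs_mult: "continuous_on A (\<lambda>x. c * x::'k::nonarch_valued_field)"
proof (rule continuous_on_subset[OF lipschitz_on_continuous_on])
  show "(nabs c)-lipschitz_on UNIV ((*) c)"
    by (rule lipschitz_onI) (simp_all add: dist_nabs nabs_mult flip: right_diff_distrib)
qed auto

subsection \<open>Fractional ideals\<close>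

lemma ideal_power_0 [simp]: "0 \<in> ideal_power n"
  by (simp add: ideal_power_def)

lemma ideal_power_add: "x \<in> ideal_power n \<Longrightarrow> y \<in> ideal_power n \<Longrightarrow> x + y \<in> ideal_power n"
  using nabs_add_le[of x y] by (auto simp: ideal_power_def)

lemma ideal_power_diff: "x \<in> ideal_power n \<Longrightarrow> y \<in> ideal_power n \<Longrightarrow> x - y \<in> ideal_power n"
  using nabs_diff_le[of x y] by (auto simp: ideal_power_def)

lemma mem_coset_ideal_power: "x \<in> (+) c ` ideal_power n \<longleftrightarrow> x - c \<in> ideal_power n"
  by (metis add_diff_cancel_left' diff_add_cancel add.commute image_iff)

text \<open>The ideal is an additive group; in metric terms, every point of an ultrametric ball is a
  centre of it.\<close>

lemma coset_ideal_power_cong: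
  assumes "x \<in> (+) c ` ideal_power n"
  shows "(+) c ` ideal_power n = (+) x ` ideal_power n"
proof -
  have x: "x - c \<in> ideal_power n"
    using assms by (simp add: mem_coset_ideal_power)
  have "y - c \<in> ideal_power n \<longleftrightarrow> y - x \<in> ideal_power n" for y
    using ideal_power_diff[OF _ x, of "y - c"] ideal_power_add[OF _ x, of "y - x"] by auto
  then show ?thesis
    by (auto simp only: set_eq_iff mem_coset_ideal_power)
qed

lemma open_if_ideal_power_cosets:
  fixes U :: "'k::nonarch_local_field_char_0 set"
  assumes "\<And>x. x \<in> U \<Longrightarrow> \<exists>n. (+) x ` ideal_power n \<subseteq> U"
  shows "open U"
  unfolding open_dist
proof
  fix x assume "x \<in> U"
  then obtain n where n: "(+) x ` ideal_power n \<subseteq> U"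
    using assms by blast
  show "\<exists>e>0. \<forall>y. dist y x < e \<longrightarrow> y \<in> U"
  proof (intro exI conjI allI impI)
    show "real (residue_card TYPE('k)) powi (- n) > 0"
      using residue_card_ge_2[where 'k='k] by simp
    fix y assume "dist y x < real (residue_card TYPE('k)) powi (- n)"
    then have "y \<in> (+) x ` ideal_power n"
      unfolding mem_coset_ideal_power by (simp add: ideal_power_def dist_nabs)
    then show "y \<in> U" using n by blast
  qed
qed

lemma open_imp_ideal_power_coset:
  fixes U :: "'k::nonarch_local_field_char_0 set"
  assumes "open U" "x \<in> U"
  shows "\<exists>n::nat. (+) x ` ideal_power (int n) \<subseteq> U"
proof -
  obtain e where e: "e > 0" "\<forall>y. dist y x < e \<longrightarrow> y \<in> U"
    using assms unfolding open_dist by blast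
  \<comment> \<open>Half of \<open>e\<close>: ideals are closed balls, while
    \<open>open_dist\<close> asks for a strict inequality.\<close>
  obtain n where n: "real (residue_card TYPE('k)) powi (- int n) \<le> e / 2"
    using exists_residue_power_le[of "e / 2"] e by auto
  have "(+) x ` ideal_power (int n) \<subseteq> U"
  proof safe
    fix y assume "y \<in> (ideal_power (int n) :: 'k set)"
    then have "dist (x + y) x < e"
      using e(1) n by (simp add: ideal_power_def dist_nabs)
    then show "x + y \<in> U" using e(2) by blast
  qed
  then show ?thesis ..
qed

lemma open_coset_ideal_power: "open ((+) c ` ideal_power n)"
  by (rule open_if_ideal_power_cosets) (metis coset_ideal_power_cong order_refl)

lemma open_ideal_power: "open (ideal_power n)"
  using open_coset_ideal_power[of 0 n] by simp

lemma closed_ideal_power: "closed (ideal_power n)"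
proof -
  have "open (- ideal_power n)"
  proof (rule open_if_ideal_power_cosets)
    fix x assume x: "x \<in> - ideal_power n"
    have "(+) x ` ideal_power n \<subseteq> - ideal_power n"
    proof safe
      fix y assume "y \<in> ideal_power n" "x + y \<in> ideal_power n"
      then have "x + y - y \<in> ideal_power n" by (intro ideal_power_diff)
      then show False using x by simp
    qed
    then show "\<exists>m. (+) x ` ideal_power m \<subseteq> - ideal_power n" ..
  qed
  then show ?thesis by (simp add: closed_def)
qed

text \<open>Dividing by an element \<open>w\<close> of absolute value q^(-m) carries P^m to the
  valuation ring, where representatives of the finitely many residue classes suffice modulo the
  maximal ideal. Multiplying back by \<open>w\<close> gives the translates.\<close>

lemma ideal_power_cover_step:
  "\<exists>F. finite F \<and> (ideal_power m :: 'k::nonarch_local_field_char_0 set) \<subseteq>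
    (\<Union>c\<in>F. (+) c ` ideal_power (m + 1))"
proof -
  let ?q = "real (residue_card TYPE('k))"
  have q: "?q > 1" using residue_card_ge_2[where 'k='k] by simp
  obtain w :: 'k where w: "nabs w = ?q powi (- m)"
    using exists_nabs_eq by blast
  have w0: "nabs w > 0" using q w by simp
  let ?R = "{(x, y). x \<in> (valuation_ring :: 'k set) \<and> y \<in> valuation_ring \<and> x - y \<in> maximal_ideal}"
  let ?F = "(\<lambda>C. w * (SOME r. r \<in> C)) ` (residue_field :: 'k set set)"
  have "x \<in> (\<Union>c\<in>?F. (+) c ` ideal_power (m + 1))" if "x \<in> ideal_power m" for x
  proof -
    define y where "y = x / w"
    have x: "x = w * y" using w0 by (auto simp: y_def)
    have y: "y \<in> valuation_ring"
      using that w0 w by (simp add: valuation_ring_def ideal_power_def y_def nabs_divide)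
    define C where "C = ?R `` {y}"
    have C: "C \<in> residue_field"
      using y by (auto simp: C_def residue_field_def quotient_def)
    define r where "r = (SOME r. r \<in> C)"
    have "y \<in> C" using y by (auto simp: C_def maximal_ideal_def)
    then have "r \<in> C" unfolding r_def by (rule someI)
    then have yr: "nabs (y - r) < 1" by (auto simp: C_def maximal_ideal_def)
    \<comment> \<open>Discreteness of the value group: an absolute value below 1 is at most 1/q,
      which is what leads from the maximal ideal to the next ideal power.\<close>
    have "nabs (y - r) \<le> 1 / ?q"
    proof (cases "y = r")
      case False
      then obtain n where n: "nabs (y - r) = ?q powi n"
        using nabs_value[of "y - r"] by auto
      have "n < 0"
      proof (rule ccontr)
        assume "\<not> n < 0"
        then have "?q powi n \<ge> 1" using q by (intro one_le_power_int) auto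
        then show False using n yr by simp
      qed
      then have "?q powi n \<le> ?q powi (- 1)"
        using q by (intro power_int_increasing) auto
      then show ?thesis using n by (simp add: power_int_minus inverse_eq_divide)
    qed (use q in simp)
    then have "nabs (w * (y - r)) \<le> ?q powi (- m) * (1 / ?q)"
      unfolding nabs_mult w using q by (intro mult_left_mono) auto
    also have "\<dots> = ?q powi (- (m + 1))"
      using q by (simp add: power_int_diff)
    finally have "x - w * r \<in> ideal_power (m + 1)"
      by (simp add: ideal_power_def x right_diff_distrib)
    then have "x \<in> (+) (w * r) ` ideal_power (m + 1)"
      by (simp only: mem_coset_ideal_power)
    then show ?thesis
      using C unfolding r_def by (rule UN_I[rotated, OF _ imageI])
  qed
  moreover have "finite ?F"
    by (intro finite_imageI finite_residue_field)
  ultimately show ?thesis by (intro exI[of _ ?F] conjI subsetI)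
qed

lemma ideal_power_cover:
  "\<exists>F. finite F \<and> (ideal_power m :: 'k::nonarch_local_field_char_0 set) \<subseteq>
    (\<Union>c\<in>F. (+) c ` ideal_power (m + int j))"
proof (induction j)
  case 0
  then show ?case by (intro exI[of _ "{0}"]) auto
next
  case (Suc j)
  then obtain F where F: "finite F" "(ideal_power m :: 'k set) \<subseteq>
    (\<Union>c\<in>F. (+) c ` ideal_power (m + int j))" by blast
  obtain G where G: "finite G" "(ideal_power (m + int j) :: 'k set) \<subseteq>
    (\<Union>c\<in>G. (+) c ` ideal_power (m + int j + 1))"
    using ideal_power_cover_step by blast
  let ?H = "(\<lambda>(a, b). a + b) ` (F \<times> G)"
  have "x \<in> (\<Union>c\<in>?H. (+) c ` ideal_power (m + int (Suc j)))" if x: "x \<in> ideal_power m" for x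
  proof -
    obtain a where "a \<in> F" "x \<in> (+) a ` ideal_power (m + int j)"
      using F x by blast
    then obtain y where a: "a \<in> F" "x = a + y" "y \<in> ideal_power (m + int j)"
      by blast
    then obtain b where "b \<in> G" "y \<in> (+) b ` ideal_power (m + int j + 1)"
      using G by blast
    then obtain z where b: "b \<in> G" "y = b + z" "z \<in> ideal_power (m + int j + 1)"
      by blast
    have "x = a + b + z" using a b by simp
    moreover have "z \<in> ideal_power (m + int (Suc j))"
      using b(3) by (simp add: ac_simps)
    ultimately show ?thesis using a(1) b(1) by force
  qed
  then show ?case using F(1) G(1) by (intro exI[of _ ?H] conjI subsetI finite_imageI finite_cartesian_product)
qed

lemma finite_ideal_power_cover:
  "\<exists>F. finite F \<and> (ideal_power m :: 'k::nonarch_local_field_char_0 set) \<subseteq>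
    (\<Union>c\<in>F. (+) c ` ideal_power n)"
proof (cases "m \<le> n")
  case True
  then show ?thesis using ideal_power_cover[of m "nat (n - m)"] by simp
next
  case False
  then show ?thesis using ideal_power_antimono[of n m] by (intro exI[of _ "{0}"]) auto
qed

text \<open>Complete because closed in a complete space, and totally bounded because finitely many
  cosets of a small ideal cover it.\<close>

lemma compact_ideal_power: "compact (ideal_power m :: 'k::nonarch_local_field_char_0 set)"
  unfolding compact_eq_totally_bounded
proof (intro conjI allI impI)
  show "complete (ideal_power m :: 'k set)"
    using closed_ideal_power by (simp add: complete_eq_closed)
  fix e :: real assume "e > 0"
  then obtain n where n: "real (residue_card TYPE('k)) powi (- int n) \<le> e / 2"
    using exists_residue_power_le[of "e / 2"] by auto
  obtain F where F: "finite F" "(ideal_power m :: 'k set) \<subseteq> (\<Union>c\<in>F. (+) c ` ideal_power (int n))"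
    using finite_ideal_power_cover[of m "int n"] by (elim exE conjE)
  have "(+) c ` ideal_power (int n) \<subseteq> ball c e" for c :: 'k
  proof (rule image_subsetI)
    fix y assume "y \<in> (ideal_power (int n) :: 'k set)"
    then have "nabs y \<le> e / 2"
      using n unfolding ideal_power_def by (blast intro: order_trans)
    moreover have "dist c (c + y) = nabs y"
      unfolding dist_nabs by simp
    ultimately show "c + y \<in> ball c e"
      unfolding mem_ball using \<open>e > 0\<close> by linarith
  qed
  then have "(\<Union>c\<in>F. (+) c ` ideal_power (int n)) \<subseteq> (\<Union>x\<in>F. ball x e)"
    by (intro UN_mono order_refl)
  then show "\<exists>F. finite F \<and> (ideal_power m :: 'k set) \<subseteq> (\<Union>x\<in>F. ball x e)"
    using F by (metis order_trans)
qed

lemma ideal_power_UNIV: "(\<Union>i::nat. ideal_power (- int i)) = (UNIV :: 'k::nonarch_local_field_char_0 set)"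
  using exists_residue_power_ge[where 'k='k] by (auto simp: ideal_power_def)

lemma countable_ideal_power_cover:
  "\<exists>D. countable D \<and> (\<Union>c\<in>D. (+) c ` ideal_power n) = (UNIV :: 'k::nonarch_local_field_char_0 set)"
proof -
  have "\<forall>i::nat. \<exists>F. finite F \<and> (ideal_power (- int i) :: 'k set) \<subseteq> (\<Union>c\<in>F. (+) c ` ideal_power n)"
    using finite_ideal_power_cover by blast
  then obtain F where F: "\<And>i::nat. finite (F i)"
      "\<And>i. (ideal_power (- int i) :: 'k set) \<subseteq> (\<Union>c\<in>F i. (+) c ` ideal_power n)"
    by metis
  have "(\<Union>i::nat. ideal_power (- int i)) \<subseteq> (\<Union>i. \<Union>c\<in>F i. (+) c ` ideal_power n)"
    by (intro UN_mono order_refl F(2))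
  then have "(\<Union>c\<in>(\<Union>i. F i). (+) c ` ideal_power n) = UNIV"
    by (simp add: ideal_power_UNIV UN_UN_flatten top.extremum_unique)
  moreover have "countable (\<Union>i. F i)"
    using F(1) by (simp add: countable_finite)
  ultimately show ?thesis by (intro exI conjI)
qed

subsection \<open>Haar measure\<close>

lemma haar_measure_ideal_power:
  fixes dx :: "'k::nonarch_local_field_char_0 measure"
  assumes "haar_measure dx"
  shows "emeasure dx (ideal_power n) < \<infinity>" "measure dx (ideal_power n) > 0"
proof -
  have sets: "sets dx = sets borel"
    using assms by (simp add: haar_measure_def)
  show fin: "emeasure dx (ideal_power n) < \<infinity>"
    using assms compact_ideal_power unfolding haar_measure_def by blast
  \<comment> \<open>Countably many translates of the ideal cover the field, so a null ideal would
    make the whole measure vanish.\<close>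
  have "emeasure dx (ideal_power n) \<noteq> 0"
  proof
    assume *: "emeasure dx (ideal_power n) = 0"
    obtain D :: "'k set" where D: "countable D" "(\<Union>c\<in>D. (+) c ` ideal_power n) = UNIV"
      using countable_ideal_power_cover[of n] by (elim exE conjE)
    have "(+) c ` ideal_power n \<in> null_sets dx" for c
    proof -
      have "emeasure dx ((+) c ` ideal_power n) = emeasure dx (ideal_power n)"
        using assms borel_open[OF open_ideal_power] unfolding haar_measure_def by metis
      moreover have "(+) c ` ideal_power n \<in> sets dx"
        using assms borel_open[OF open_coset_ideal_power] unfolding haar_measure_def by metis
      ultimately show ?thesis using * by auto
    qed
    then have "(\<Union>c\<in>D. (+) c ` ideal_power n) \<in> null_sets dx"
      by (intro null_sets_UN' D)
    then show False
      using assms D by (auto simp: haar_measure_def null_sets_def)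
  qed
  then show "measure dx (ideal_power n) > 0"
    using fin by (simp add: measure_def enn2real_positive_iff zero_less_iff_neq_zero)
qed

section \<open>Invariance of Haar measure under multiplication by units\<close>

lemma sets_borel_ideal_power_cosets:
  "sets (borel :: 'k::nonarch_local_field_char_0 measure) =
    sigma_sets UNIV (insert {} (range (\<lambda>(c, n). (+) c ` ideal_power n)))" (is "_ = sigma_sets _ ?E")
proof -
  have "sigma_sets UNIV {S :: 'k set. open S} = sigma_sets UNIV ?E"
  proof (rule sigma_sets_eqI)
    show "S \<in> sigma_sets UNIV ?E" if "S \<in> {S. open S}" for S :: "'k set"
    proof -
      \<comment> \<open>At each level countably many cosets cover the field. An open set is the
        union of those chosen cosets that lie inside it, because a chosen coset through
        \<open>x\<close> equals the coset centred at \<open>x\<close>.\<close>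
      have "\<forall>n. \<exists>D. countable D \<and> (\<Union>c\<in>D. (+) c ` ideal_power n) = (UNIV :: 'k set)"
        using countable_ideal_power_cover by blast
      then obtain D where D: "\<And>n. countable (D n)"
          "\<And>n. (\<Union>c\<in>D n. (+) c ` ideal_power n) = (UNIV :: 'k set)"
        by metis
      define \<A> where "\<A> = {A \<in> (\<Union>n::nat. (\<lambda>c. (+) c ` ideal_power (int n)) ` D (int n)). A \<subseteq> S}"
      have "S \<subseteq> \<Union>\<A>"
      proof
        fix x assume "x \<in> S"
        then obtain n where n: "(+) x ` ideal_power (int n) \<subseteq> S"
          using \<open>S \<in> _\<close> open_imp_ideal_power_coset by blast
        obtain c where c: "c \<in> D (int n)" "x \<in> (+) c ` ideal_power (int n)"
          using D(2)[of "int n"] by blast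
        with n have "(+) c ` ideal_power (int n) \<subseteq> S"
          using coset_ideal_power_cong by metis
        then show "x \<in> \<Union>\<A>"
          unfolding \<A>_def using c by blast
      qed
      then have "S = \<Union>\<A>" by (auto simp: \<A>_def)
      moreover have "countable \<A>"
        unfolding \<A>_def using D(1) by (intro countable_subset[OF Collect_subset]) auto
      moreover have "A \<in> sigma_sets UNIV ?E" if "A \<in> \<A>" for A
        using that by (intro sigma_sets.Basic) (auto simp: \<A>_def)
      ultimately show ?thesis
        using sigma_sets_UNION by blast
    qed
    show "A \<in> sigma_sets UNIV {S. open S}" if "A \<in> ?E" for A
      using that open_coset_ideal_power by (intro sigma_sets.Basic) auto
  qed
  then show ?thesis by (simp add: borel_def)
qed

text \<open>Two balls in an ultrametric space are disjoint or nested; the empty set is among the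
  generators to cover the disjoint case.\<close>

lemma Int_stable_ideal_power_cosets:
  "Int_stable (insert {} (range (\<lambda>(c, n). (+) c ` ideal_power n)))" (is "Int_stable ?E")
proof -
  have "A \<inter> B = {} \<or> A \<inter> B = A \<or> A \<inter> B = B"
    if "A = (+) c ` ideal_power m" "B = (+) d ` ideal_power n" for A B :: "'a set" and c d m n
  proof (cases "A \<inter> B = {}")
    case False
    then obtain x where x: "x \<in> A" "x \<in> B" by blast
    have "A = (+) x ` ideal_power m" "B = (+) x ` ideal_power n"
      using x that coset_ideal_power_cong by metis+
    moreover have "ideal_power m \<subseteq> (ideal_power n :: 'a set) \<or> ideal_power n \<subseteq> (ideal_power m :: 'a set)"
      using ideal_power_antimono linear by metis
    ultimately show ?thesis by blast
  qed simp
  then have *: "A \<inter> B = {} \<or> A \<inter> B = A \<or> A \<inter> B = B"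
    if "A \<in> ?E" "B \<in> ?E" for A B
    using that by (elim insertE rangeE) (simp_all split: prod.splits)
  show ?thesis
  proof (rule Int_stableI)
    fix A B assume "A \<in> ?E" "B \<in> ?E"
    then show "A \<inter> B \<in> ?E"
      using *[of A B] by (metis insertI1)
  qed
qed

text \<open>Multiplication by a unit permutes the cosets of each ideal, and translation invariance
  gives these the same measure. So both measures agree on an intersection-stable generator of the
  Borel sets that contains an exhaustion by sets of finite measure.\<close>

lemma haar_measure_distr_unit:
  fixes dx :: "'k::nonarch_local_field_char_0 measure"
  assumes haar: "haar_measure dx" and u: "nabs u = 1"
  shows "distr dx borel ((*) u) = dx"
proof -
  have sets [measurable_cong]: "sets dx = sets borel"
    using haar by (simp add: haar_measure_def)
  have space [simp]: "space dx = UNIV"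
    using sets_eq_imp_space_eq[OF sets] by simp
  have u0: "u \<noteq> 0" using u by auto
  have meas [measurable]: "(*) u \<in> borel_measurable borel"
    by (intro borel_measurable_continuous_onI continuous_on_nabs_mult)
  have coset: "emeasure dx ((+) c ` ideal_power n) = emeasure dx (ideal_power n)" for c n
    using haar borel_open[OF open_ideal_power] unfolding haar_measure_def by metis
  have vimage: "(*) u -` ((+) c ` ideal_power n) = (+) (c / u) ` ideal_power n" for c n
  proof -
    have "nabs (u * x - c) = nabs (x - c / u)" for x
    proof -
      have "u * x - c = u * (x - c / u)" using u0 by (simp add: right_diff_distrib)
      then show ?thesis using u by (simp add: nabs_mult)
    qed
    then show ?thesis
      unfolding set_eq_iff vimage_eq mem_coset_ideal_power by (simp add: ideal_power_def)
  qed
  let ?E = "insert {} (range (\<lambda>(c, n). (+) c ` ideal_power n)) :: 'k set set"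
  show ?thesis
  proof (rule measure_eqI_generator_eq[OF Int_stable_ideal_power_cosets, where \<Omega>=UNIV
        and A="\<lambda>i. ideal_power (- int i)"])
    show "sets (distr dx borel ((*) u)) = sigma_sets UNIV ?E" "sets dx = sigma_sets UNIV ?E"
      by (simp_all add: sets sets_borel_ideal_power_cosets)
    show "emeasure (distr dx borel ((*) u)) X = emeasure dx X" if X: "X \<in> ?E" for X
    proof (cases "X = {}")
      case False
      with X obtain c n where X: "X = (+) c ` ideal_power n" by auto
      have "emeasure (distr dx borel ((*) u)) X = emeasure dx ((*) u -` X)"
        by (subst emeasure_distr) (auto simp: X intro!: borel_open open_coset_ideal_power)
      then show ?thesis unfolding X vimage coset by simp
    qed simp
    show "range (\<lambda>i. ideal_power (- int i)) \<subseteq> ?E"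
    proof
      fix A :: "'k set" assume "A \<in> range (\<lambda>i. ideal_power (- int i))"
      then obtain i where "A = (\<lambda>(c, n). (+) c ` ideal_power n) (0, - int i)"
        by auto
      then show "A \<in> ?E" by blast
    qed
    show "emeasure (distr dx borel ((*) u)) (ideal_power (- int i)) \<noteq> \<infinity>" for i
    proof -
      have "emeasure (distr dx borel ((*) u)) (ideal_power (- int i)) =
          emeasure dx ((*) u -` ((+) 0 ` ideal_power (- int i)))"
        by (subst emeasure_distr) (auto intro!: borel_open open_ideal_power)
      then show ?thesis
        unfolding vimage coset using haar_measure_ideal_power(1)[OF haar] by (simp add: less_top)
    qed
  qed (use ideal_power_UNIV in auto)
qed

text \<open>If \<open>g\<close> is not measurable, both integrals are \<open>0\<close> by convention.\<close>

lemma haar_integral_unit: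
  fixes dx :: "'k::nonarch_local_field_char_0 measure" and g :: "'k \<Rightarrow> complex"
  assumes haar: "haar_measure dx" and u: "nabs u = 1"
  shows "(LINT x|dx. g (u * x)) = (LINT x|dx. g x)"
proof -
  have sets [measurable_cong]: "sets dx = sets borel"
    using haar by (simp add: haar_measure_def)
  have meas [measurable]: "(*) c \<in> borel_measurable borel" for c :: 'k
    by (intro borel_measurable_continuous_onI continuous_on_nabs_mult)
  have u0: "u \<noteq> 0" using u by auto
  show ?thesis
  proof (cases "g \<in> borel_measurable borel")
    case True
    then have "(LINT x|distr dx borel ((*) u). g x) = (LINT x|dx. g (u * x))"
      by (intro integral_distr) simp_all
    then show ?thesis by (simp add: haar_measure_distr_unit[OF assms])
  next
    case False
    have "(\<lambda>x. g (u * x)) \<notin> borel_measurable borel"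
    proof
      assume "(\<lambda>x. g (u * x)) \<in> borel_measurable borel"
      then have "(\<lambda>x. g (u * (inverse u * x))) \<in> borel_measurable borel"
        by (rule measurable_compose[OF meas])
      then show False using False u0 by (simp flip: mult.assoc)
    qed
    then have "\<not> integrable dx g" "\<not> integrable dx (\<lambda>x. g (u * x))"
      using False borel_measurable_integrable measurable_cong_sets[OF sets refl] by metis+
    then show ?thesis by (simp add: not_integrable_integral_eq)
  qed
qed


subsection \<open>Squares, the Hilbert symbol and the Weil constant\<close>

text \<open>Writing \<open>t = 1 + y\<close>, the equation \<open>t\<^sup>2 = 1 + z\<close> becomes the fixed point equation
  \<open>y = (z - y\<^sup>2) / 2\<close>, a contraction near \<open>0\<close>.\<close>

lemma exists_sqrt_one_plus:
  "\<exists>e>0. \<forall>z::'k::nonarch_local_field_char_0. nabs z < e \<longrightarrow> (\<exists>t. nabs t = 1 \<and> t\<^sup>2 = 1 + z)"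
proof (rule exI, intro conjI allI impI)
  define c where "c = nabs (2::'k)"
  have c0: "c > 0" by (simp add: c_def)
  have c1: "c \<le> 1" using nabs_add_le[of "1::'k" 1] by (simp add: c_def)
  \<comment> \<open>Division by 2 multiplies absolute values by \<open>1 / c\<close>. The radius
    \<open>c / 2\<close> of the ball makes the contraction factor at most 1/2, and the bound
    \<open>c * (c / 2)\<close> on \<open>z\<close> keeps the map inside that ball.\<close>
  show "c * (c / 2) > 0" using c0 by simp
  fix z :: 'k assume z: "nabs z < c * (c / 2)"
  define S where "S = {y::'k. nabs y \<le> c / 2}"
  have "S = cball 0 (c / 2)"
    by (auto simp: S_def dist_nabs)
  then have S: "complete S" by (simp add: complete_eq_closed)
  have "\<exists>!y\<in>S. (z - y\<^sup>2) / 2 = y"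
  proof (rule Banach_fix[OF S, where c="1/2"])
    show "S \<noteq> {}" using c0 by (auto simp: S_def intro!: exI[of _ 0])
    show "(\<lambda>y. (z - y\<^sup>2) / 2) ` S \<subseteq> S"
    proof (rule image_subsetI)
      fix y assume "y \<in> S"
      then have y: "nabs y \<le> c / 2" by (simp add: S_def)
      then have "(nabs y)\<^sup>2 \<le> (c / 2)\<^sup>2" by (intro power_mono) auto
      also have "\<dots> \<le> c * (c / 2)" using c0 by (simp add: power2_eq_square)
      finally have "nabs (z - y\<^sup>2) \<le> c * (c / 2)"
        using z nabs_diff_le[of z "y\<^sup>2"] by (simp add: nabs_power)
      then have "nabs ((z - y\<^sup>2) / 2) \<le> c / 2"
        unfolding nabs_divide c_def[symmetric] using c0 by (simp add: field_simps)
      then show "(z - y\<^sup>2) / 2 \<in> S" by (simp add: S_def)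
    qed
    fix x y assume xy: "x \<in> S" "y \<in> S"
    have "(z - x\<^sup>2) / 2 - (z - y\<^sup>2) / 2 = - ((x - y) * (x + y) / 2)"
      by (simp add: field_simps power2_eq_square)
    then have "dist ((z - x\<^sup>2) / 2) ((z - y\<^sup>2) / 2) = nabs (x - y) * (nabs (x + y) / c)"
      unfolding dist_nabs by (simp only: nabs_minus nabs_mult nabs_divide c_def times_divide_eq_right)
    also have "\<dots> \<le> nabs (x - y) * (1 / 2)"
      using c0 xy nabs_add_le[of x y] by (intro mult_left_mono) (auto simp: S_def field_simps)
    finally show "dist ((z - x\<^sup>2) / 2) ((z - y\<^sup>2) / 2) \<le> 1 / 2 * dist x y"
      by (simp add: dist_nabs)
  qed auto
  then obtain y where y: "nabs y \<le> c / 2" "(z - y\<^sup>2) / 2 = y"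
    unfolding S_def by blast
  have "z = 2 * y + y\<^sup>2"
    using y(2) by (simp add: field_simps)
  then have "(1 + y)\<^sup>2 = 1 + z"
    by (simp add: power2_eq_square algebra_simps)
  moreover have "nabs (1 + y) = 1"
    using y(1) c0 c1 by (intro nabs_one_plus) linarith
  ultimately show "\<exists>t. nabs t = 1 \<and> t\<^sup>2 = 1 + z" by blast
qed

lemma hilbert_symbol_square: "hilbert_symbol ((t::'k::field)\<^sup>2) b = 1"
proof -
  have "(1, 0, t) \<noteq> (0::'k, 0::'k, 0) \<and> t\<^sup>2 = t\<^sup>2 * 1\<^sup>2 + b * 0\<^sup>2"
    by simp
  then show ?thesis unfolding hilbert_symbol_def by (smt (verit, best))
qed

lemma hilbert_symbol_1_left: "hilbert_symbol 1 b = 1"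
  using hilbert_symbol_square[of 1 b] by simp

lemma hilbert_symbol_1_right: "hilbert_symbol a 1 = 1"
proof -
  have "(0, 1, 1) \<noteq> (0::'a, 0::'a, 0::'a) \<and> 1\<^sup>2 = a * 0\<^sup>2 + 1 * 1\<^sup>2"
    by simp
  then show ?thesis unfolding hilbert_symbol_def by (smt (verit, best))
qed

lemma schwartz_bruhat_scale:
  assumes \<Phi>: "\<Phi> \<in> schwartz_bruhat" and u: "u \<noteq> 0"
  shows "(\<lambda>x. \<Phi> (u * x)) \<in> schwartz_bruhat"
  unfolding schwartz_bruhat_def mem_Collect_eq
proof (intro conjI allI)
  fix x
  obtain U where U: "open U" "u * x \<in> U" "\<Phi> constant_on U"
    using \<Phi> unfolding schwartz_bruhat_def by blast
  have "open ((*) u -` U)"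
    using U(1) continuous_on_nabs_mult by (intro open_vimage)
  then show "\<exists>V. open V \<and> x \<in> V \<and> (\<lambda>x. \<Phi> (u * x)) constant_on V"
    using U by (intro exI[of _ "(*) u -` U"]) (auto simp: constant_on_def)
next
  obtain K where K: "compact K" "\<And>x. x \<notin> K \<Longrightarrow> \<Phi> x = 0"
    using \<Phi> unfolding schwartz_bruhat_def by blast
  have "compact ((*) (inverse u) ` K)"
    using K(1) continuous_on_nabs_mult by (intro compact_continuous_image)
  moreover have "\<Phi> (u * x) = 0" if "x \<notin> (*) (inverse u) ` K" for x
  proof (rule K(2))
    show "u * x \<notin> K"
    proof
      assume "u * x \<in> K"
      then have "inverse u * (u * x) \<in> (*) (inverse u) ` K" by (rule imageI)
      then show False using that u by (simp flip: mult.assoc)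
    qed
  qed
  ultimately show "\<exists>K. compact K \<and> (\<forall>x. x \<notin> K \<longrightarrow> \<Phi> (u * x) = 0)" by blast
qed

text \<open>Replacing the test function \<open>\<Phi>\<close> by \<open>x \<mapsto> \<Phi> (t x)\<close> identifies the two defining predicates, so
  the \<open>THE\<close> terms agree whether or not the constants exist.\<close>

lemma weil_constant_unit_square:
  fixes dx :: "'k::nonarch_local_field_char_0 measure"
  assumes haar: "haar_measure dx" and t: "nabs t = 1"
  shows "weil_constant dx \<psi> (a * t\<^sup>2) = weil_constant dx \<psi> a"
proof -
  define P where "P = (\<lambda>a \<alpha> \<Phi>. (LINT x|dx. fourier dx (\<lambda>t. \<psi> (- 2 * t)) \<Phi> x * \<psi> (a * x\<^sup>2)) =
    of_real (nabs a powr (- 1 / 2)) * \<alpha> * (LINT x|dx. \<Phi> x * \<psi> (- inverse a * x\<^sup>2)))"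
  have t0: "t \<noteq> 0" using t by auto
  have P: "P (a * t\<^sup>2) \<alpha> \<Phi> \<longleftrightarrow> P a \<alpha> (\<lambda>x. \<Phi> (t * x))" for \<alpha> \<Phi>
  proof -
    let ?F = "fourier dx (\<lambda>t. \<psi> (- 2 * t))"
    \<comment> \<open>The transform of the rescaled test function is the transform of
      \<open>\<Phi>\<close> rescaled by \<open>inverse t\<close>; no Jacobian appears because
      \<open>t\<close> is a unit.\<close>
    have F: "?F (\<lambda>x. \<Phi> (t * x)) (t * y) = ?F \<Phi> y" for y
    proof -
      have "?F \<Phi> y = (LINT x|dx. \<Phi> (t * x) * \<psi> (- 2 * (y * (t * x))))"
        unfolding fourier_def by (rule haar_integral_unit[OF haar t, symmetric])
      then show ?thesis unfolding fourier_def by (simp add: ac_simps)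
    qed
    have "(LINT x|dx. ?F (\<lambda>x. \<Phi> (t * x)) x * \<psi> (a * x\<^sup>2)) =
        (LINT x|dx. ?F (\<lambda>x. \<Phi> (t * x)) (t * x) * \<psi> (a * (t * x)\<^sup>2))"
      by (rule haar_integral_unit[OF haar t, symmetric])
    also have "\<dots> = (LINT x|dx. ?F \<Phi> x * \<psi> (a * t\<^sup>2 * x\<^sup>2))"
      by (simp only: F power_mult_distrib mult.assoc)
    finally have 1: "(LINT x|dx. ?F (\<lambda>x. \<Phi> (t * x)) x * \<psi> (a * x\<^sup>2)) =
        (LINT x|dx. ?F \<Phi> x * \<psi> (a * t\<^sup>2 * x\<^sup>2))" .
    have "(LINT x|dx. \<Phi> x * \<psi> (- inverse (a * t\<^sup>2) * x\<^sup>2)) =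
        (LINT x|dx. \<Phi> (t * x) * \<psi> (- inverse (a * t\<^sup>2) * (t * x)\<^sup>2))"
      by (rule haar_integral_unit[OF haar t, symmetric])
    also have "\<dots> = (LINT x|dx. \<Phi> (t * x) * \<psi> (- inverse a * x\<^sup>2))"
    proof -
      \<comment> \<open>The case \<open>a = 0\<close> relies on
        \<open>inverse 0 = 0\<close>.\<close>
      have "- inverse (a * t\<^sup>2) * (t * x)\<^sup>2 = - inverse a * x\<^sup>2" for x
        using t0 by (cases "a = 0") (simp_all add: field_simps)
      then show ?thesis by (simp only:)
    qed
    finally show ?thesis
      unfolding P_def 1 using t by (simp only: nabs_mult nabs_power power_one mult_1_right)
  qed
  have "(\<forall>\<Phi>\<in>schwartz_bruhat. P (a * t\<^sup>2) \<alpha> \<Phi>) \<longleftrightarrow> (\<forall>\<Phi>\<in>schwartz_bruhat. P a \<alpha> \<Phi>)" for \<alpha>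
  proof (intro iffI ballI)
    fix \<Phi> :: "'k \<Rightarrow> complex" assume *: "\<forall>\<Phi>\<in>schwartz_bruhat. P (a * t\<^sup>2) \<alpha> \<Phi>" "\<Phi> \<in> schwartz_bruhat"
    then have "P (a * t\<^sup>2) \<alpha> (\<lambda>x. \<Phi> (inverse t * x))"
      using schwartz_bruhat_scale[of \<Phi> "inverse t"] t0 by simp
    then show "P a \<alpha> \<Phi>"
      using t0 by (simp add: P flip: mult.assoc)
  qed (use P schwartz_bruhat_scale[OF _ t0] in blast)
  then show ?thesis unfolding weil_constant_def P_def by simp
qed

lemma chi_weil_unit_square:
  assumes "haar_measure dx" "nabs t = 1"
  shows "chi_weil dx \<psi> (a * t\<^sup>2) = chi_weil dx \<psi> a"
  using assms by (simp add: chi_weil_def weil_constant_unit_square)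

subsection \<open>Elements of the metaplectic cover\<close>

lemma mp_unip_carrier: "mp_unip x \<in> carrier Mp"
  by (simp add: Mp_def mp_unip_def det_2)

lemma mp_diag_carrier: "x \<noteq> 0 \<Longrightarrow> mp_diag x \<in> carrier Mp"
  by (simp add: Mp_def mp_diag_def det_2)

lemma vector_matrix_mult_2:
  "(vector [vector [a, b], vector [c, d]] :: 'k::field^2^2) **
    (vector [vector [e, f], vector [g, h]] :: 'k^2^2) =
    vector [vector [a * e + b * g, a * f + b * h], vector [c * e + d * g, c * f + d * h]]"
  by (simp add: vec_eq_iff forall_2 matrix_matrix_mult_def sum_2)

lemma mp_unip_mult: "mp_unip x \<otimes>\<^bsub>Mp\<^esub> mp_unip y = mp_unip (x + y)"
  by (simp add: Mp_def mp_unip_def vector_matrix_mult_2 kubota_cocycle_def kubota_chi_def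
      hilbert_symbol_1_left add.commute)

text \<open>In both products \<open>kubota_chi\<close> of the result equals that of the diagonal
  factor, so one argument of the Hilbert symbol is 1 and no sign appears.\<close>

lemma mp_diag_unip_mult:
  assumes "x \<noteq> 0"
  shows "mp_diag x \<otimes>\<^bsub>Mp\<^esub> mp_unip a = mp_unip (x\<^sup>2 * a) \<otimes>\<^bsub>Mp\<^esub> mp_diag x"
proof -
  have eq: "x\<^sup>2 * a * inverse x = x * a"
    using assms by (simp add: field_simps power2_eq_square)
  show ?thesis
    using assms by (simp add: Mp_def mp_unip_def mp_diag_def vector_matrix_mult_2
        kubota_cocycle_def kubota_chi_def hilbert_symbol_1_left hilbert_symbol_1_right)
      (simp only: eq)
qed

text \<open>A product of two diagonal elements can carry a sign. When the second entry is a square,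
  the cocycle is the Hilbert symbol of \<open>(inverse t)\<^sup>2\<close> and
  \<open>inverse x\<close>, which is 1.\<close>

lemma mp_diag_mult_square:
  assumes "x \<noteq> 0" "t \<noteq> 0"
  shows "mp_diag x \<otimes>\<^bsub>Mp\<^esub> mp_diag (t\<^sup>2) = mp_diag (x * t\<^sup>2)"
  using assms hilbert_symbol_square[of "inverse t" "inverse x"]
  by (simp add: Mp_def mp_diag_def vector_matrix_mult_2 kubota_cocycle_def kubota_chi_def
      power_one_over inverse_eq_divide)

lemma mp_unip_congruence:
  "a \<in> ideal_power (int n) \<Longrightarrow> fst (mp_unip a) \<in> congruence_subgroup n"
  by (simp add: mp_unip_def congruence_subgroup_def forall_2 mat_def det_2)

text \<open>Only the lower right entry needs care: \<open>inverse (1 + z) - 1\<close> is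
  \<open>- (z / (1 + z))\<close>, and \<open>1 + z\<close> has absolute value 1.\<close>

lemma mp_diag_congruence:
  assumes "nabs z < 1" "z \<in> ideal_power (int n)"
  shows "fst (mp_diag (1 + z)) \<in> congruence_subgroup n"
proof -
  have n: "nabs (1 + z) = 1" using assms(1) by (rule nabs_one_plus)
  then have 0: "1 + z \<noteq> 0" by auto
  then have "inverse (1 + z) - 1 = - (z / (1 + z))"
    by (simp add: field_simps)
  then have "nabs (inverse (1 + z) - 1) = nabs z"
    using n by (simp add: nabs_divide)
  then have "inverse (1 + z) - 1 \<in> ideal_power (int n)"
    using assms(2) by (simp add: ideal_power_def)
  then show ?thesis
    using assms(2) 0 by (simp add: mp_diag_def congruence_subgroup_def forall_2 mat_def det_2)
qed

text \<open>The determinant forces \<open>kubota_chi g\<close> to be nonzero, so its quotient by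
  itself is 1 and the symbol is trivial. This lets openness at the identity be read off on the lifts
  \<open>(g, 1)\<close>.\<close>

lemma mp_one_mult:
  assumes "det g = 1"
  shows "\<one>\<^bsub>Mp\<^esub> \<otimes>\<^bsub>Mp\<^esub> (g, 1) = (g, 1)"
proof -
  have "kubota_chi g \<noteq> 0"
    using assms by (auto simp: kubota_chi_def det_2)
  moreover have "kubota_chi (mat 1 :: 'a^2^2) = 1"
    by (simp add: kubota_chi_def mat_def)
  ultimately show ?thesis
    by (simp add: Mp_def kubota_cocycle_def hilbert_symbol_1_right)
qed

text \<open>The stabiliser of \<open>v\<close> is open and contains the identity, so it contains the
  lift of some congruence subgroup.\<close>

lemma smooth_fixed_congruence:
  fixes \<pi> :: "('k::nonarch_local_field_char_0^2^2) \<times> int \<Rightarrow> 'v::ab_group_add \<Rightarrow> 'v"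
  assumes "mp_rep smul \<pi>" "mp_smooth \<pi>"
  shows "\<exists>n\<ge>1. \<forall>g\<in>congruence_subgroup n. \<pi> (g, 1) v = v"
proof -
  have "mp_open {g \<in> carrier Mp. \<pi> g v = v}"
    using assms(2) by (simp add: mp_smooth_def openin_mp_topology)
  moreover have "\<one>\<^bsub>Mp\<^esub> \<in> {g \<in> carrier Mp. \<pi> g v = v}"
    using assms(1) by (auto simp: mp_rep_def Mp_def)
  ultimately obtain n where "n \<ge> 1" "\<forall>g\<in>congruence_subgroup n.
      \<one>\<^bsub>Mp\<^esub> \<otimes>\<^bsub>Mp\<^esub> (g, 1) \<in> {g \<in> carrier Mp. \<pi> g v = v}"
    unfolding mp_open_def by blast
  moreover have "\<one>\<^bsub>Mp\<^esub> \<otimes>\<^bsub>Mp\<^esub> (g, 1) = (g, 1)" if "g \<in> congruence_subgroup n" for g :: "'k^2^2"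
    using that by (intro mp_one_mult) (simp add: congruence_subgroup_def)
  ultimately show ?thesis by auto
qed

subsection \<open>The Whittaker function on the torus\<close>

text \<open>The fibres of \<open>g\<close> on \<open>ideal_power n\<close> must be finitely many and measurable: the step integral
  is \<open>0\<close> by convention if there are infinitely many of them.\<close>

lemma step_integral_eq_0_imp:
  fixes dx :: "'k::nonarch_local_field_char_0 measure"
  assumes haar: "haar_measure dx"
    and L: "module_hom smul (*) L"
    and c: "\<And>x. x \<in> ideal_power n \<Longrightarrow> L (g x) = c"
    and g: "\<And>x y. y \<in> ideal_power m \<Longrightarrow> g (x + y) = g x"
    and 0: "step_integral smul dx (ideal_power n) g = 0"
  shows "c = 0"
proof -
  let ?A = "ideal_power n :: 'k set"
  let ?B = "\<lambda>w. {x \<in> ?A. g x = w}"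
  obtain F where F: "finite F" "?A \<subseteq> (\<Union>c\<in>F. (+) c ` ideal_power m)"
    using finite_ideal_power_cover[of n m] by (elim exE conjE)
  have "g ` ?A \<subseteq> g ` F"
  proof (rule image_subsetI)
    fix x assume "x \<in> ?A"
    with F(2) have "x \<in> (\<Union>c\<in>F. (+) c ` ideal_power m)" by (rule subsetD)
    then show "g x \<in> g ` F" by (elim UN_E imageE) (simp add: g)
  qed
  then have fin: "finite (g ` ?A)"
    using F(1) finite_subset by blast
  have "open (?B w)" for w
  proof (rule open_if_ideal_power_cosets)
    fix x assume x: "x \<in> ?B w"
    have "(+) x ` ideal_power (max m n) \<subseteq> ?B w"
    proof (rule image_subsetI)
      fix y :: 'k assume "y \<in> ideal_power (max m n)"
      then have "y \<in> ideal_power m" "y \<in> ideal_power n"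
        using ideal_power_antimono[of m "max m n"] ideal_power_antimono[of n "max m n"] by auto
      then show "x + y \<in> ?B w" using x g ideal_power_add by auto
    qed
    then show "\<exists>k. (+) x ` ideal_power k \<subseteq> ?B w" ..
  qed
  then have sets: "?B w \<in> sets dx" for w
    using haar by (simp add: haar_measure_def)
  have "emeasure dx (?B w) \<le> emeasure dx ?A" for w
    using haar borel_open[OF open_ideal_power] by (intro emeasure_mono) (auto simp: haar_measure_def)
  then have "emeasure dx (?B w) \<noteq> \<infinity>" for w
    using haar_measure_ideal_power(1)[OF haar, of n] by (metis infinity_ennreal_def leD)
  then have "measure dx (\<Union>w\<in>g ` ?A. ?B w) = (\<Sum>w\<in>g ` ?A. measure dx (?B w))"
    using fin sets by (intro measure_finite_Union) (auto simp: disjoint_family_on_def)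
  moreover have "(\<Union>w\<in>g ` ?A. ?B w) = ?A" by auto
  ultimately have sum: "(\<Sum>w\<in>g ` ?A. measure dx (?B w)) = measure dx ?A" by simp
  \<comment> \<open>\<open>L\<close> takes the value \<open>c\<close> on each of the finitely many
    fibres, whose measures add up to the positive measure of the ideal.\<close>
  have "0 = L (step_integral smul dx ?A g)"
    using 0 module_hom.zero[OF L] by simp
  also have "\<dots> = (\<Sum>w\<in>g ` ?A. of_real (measure dx (?B w)) * L w)"
    unfolding step_integral_def by (simp add: module_hom.sum[OF L] module_hom.scale[OF L])
  also have "\<dots> = (\<Sum>w\<in>g ` ?A. of_real (measure dx (?B w)) * c)"
    using c by (intro sum.cong) auto
  also have "\<dots> = of_real (measure dx ?A) * c"
    by (simp add: sum[symmetric] sum_distrib_right)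
  finally show "c = 0"
    using haar_measure_ideal_power(2)[OF haar, of n] by simp
qed

section \<open>Support and local constancy of the Whittaker function\<close>

context
  fixes \<psi> :: "'k::nonarch_local_field_char_0 \<Rightarrow> complex"
    and smul :: "complex \<Rightarrow> 'v::ab_group_add \<Rightarrow> 'v"
    and \<pi> :: "('k^2^2) \<times> int \<Rightarrow> 'v \<Rightarrow> 'v"
    and \<xi> :: 'k
    and l :: "'v \<Rightarrow> complex"
  assumes rep: "mp_rep smul \<pi>"
    and smooth: "mp_smooth \<pi>"
    and whittaker: "whittaker_functional \<psi> smul \<pi> \<xi> l"
begin

lemma rep_mult:
  "g \<in> carrier Mp \<Longrightarrow> h \<in> carrier Mp \<Longrightarrow> \<pi> g (\<pi> h v) = \<pi> (g \<otimes>\<^bsub>Mp\<^esub> h) v"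
  using rep by (simp add: mp_rep_def)

lemma whittaker_diag_unip:
  assumes "x \<noteq> 0"
  shows "l (\<pi> (mp_diag x) (\<pi> (mp_unip a) v)) = \<psi> (\<xi> * (x\<^sup>2 * a)) * l (\<pi> (mp_diag x) v)"
proof -
  have "\<pi> (mp_diag x) (\<pi> (mp_unip a) v) = \<pi> (mp_unip (x\<^sup>2 * a)) (\<pi> (mp_diag x) v)"
    using assms by (simp add: rep_mult mp_diag_carrier mp_unip_carrier mp_diag_unip_mult)
  then show ?thesis using whittaker by (simp add: whittaker_functional_def)
qed

lemma whittaker_vanishes_at_infinity:
  assumes "\<xi> \<noteq> 0" and nontriv: "\<exists>y. \<psi> y \<noteq> 1"
  shows "\<exists>R. \<forall>x. x \<noteq> 0 \<longrightarrow> l (\<pi> (mp_diag x) v) \<noteq> 0 \<longrightarrow> nabs x \<le> R"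
proof -
  obtain y where y: "\<psi> y \<noteq> 1" using nontriv by blast
  obtain n where n: "\<forall>g\<in>congruence_subgroup n. \<pi> (g, 1) v = v"
    using smooth_fixed_congruence[OF rep smooth] by blast
  define Q where "Q = real (residue_card TYPE('k)) powi (- int n)"
  have Q: "Q > 0" using residue_card_ge_2[where 'k='k] by (simp add: Q_def)
  \<comment> \<open>The maximum with 1 gives |x|^2 >= |x| for |x| > \<open>R\<close>; then the
    solution \<open>a\<close> of \<open>\<xi> * (x\<^sup>2 * a) = y\<close> lies in P^n, the ball of
    radius \<open>Q\<close>.\<close>
  define R where "R = max 1 (nabs y / (nabs \<xi> * Q))"
  have "nabs x \<le> R" if x: "x \<noteq> 0" and l: "l (\<pi> (mp_diag x) v) \<noteq> 0" for x
  proof (rule ccontr)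
    assume "\<not> nabs x \<le> R"
    then have R: "nabs x > 1" "nabs x > nabs y / (nabs \<xi> * Q)" by (auto simp: R_def)
    define a where "a = y / (\<xi> * x\<^sup>2)"
    have "nabs y / (nabs \<xi> * Q) \<le> (nabs x)\<^sup>2"
      using R power_increasing[of 1 2 "nabs x"] by simp
    then have "nabs a \<le> Q"
      using Q x assms(1) by (simp add: a_def nabs_divide nabs_mult nabs_power field_simps)
    then have "a \<in> ideal_power (int n)"
      by (simp add: ideal_power_def Q_def)
    then have "\<pi> (mp_unip a) v = v"
      using n mp_unip_congruence[of a n] by (simp add: mp_unip_def)
    then have "\<psi> (\<xi> * (x\<^sup>2 * a)) = 1"
      using whittaker_diag_unip[OF x, of a v] l by simp
    moreover have "\<xi> * (x\<^sup>2 * a) = y"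
      using x assms(1) by (simp add: a_def field_simps)
    ultimately show False using y by simp
  qed
  then show ?thesis by blast
qed

lemma whittaker_vanishes_at_zero:
  assumes haar: "haar_measure dx"
    and triv: "\<forall>x\<in>valuation_ring. \<psi> x = 1"
    and supercuspidal: "mp_supercuspidal dx smul \<pi>"
    and "\<xi> \<noteq> 0"
  shows "\<exists>r>0. \<forall>x. x \<noteq> 0 \<longrightarrow> l (\<pi> (mp_diag x) v) \<noteq> 0 \<longrightarrow> r \<le> nabs x"
proof -
  obtain n where n: "step_integral smul dx (ideal_power n) (\<lambda>x. \<pi> (mp_unip x) v) = 0"
    using supercuspidal unfolding mp_supercuspidal_def by blast
  obtain m where m: "\<forall>g\<in>congruence_subgroup m. \<pi> (g, 1) v = v"
    using smooth_fixed_congruence[OF rep smooth] by blast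
  define Q where "Q = real (residue_card TYPE('k)) powi (- n)"
  have Q: "Q > 0" using residue_card_ge_2[where 'k='k] by (simp add: Q_def)
  \<comment> \<open>The minimum with 1 gives |x|^2 <= |x| for |x| < \<open>r\<close>; then
    \<open>\<xi> * (x\<^sup>2 * a)\<close> is integral for all \<open>a\<close> in P^n, the ball of
    radius \<open>Q\<close>.\<close>
  define r where "r = min 1 (1 / (nabs \<xi> * Q))"
  have "r \<le> nabs x" if x: "x \<noteq> 0" and l: "l (\<pi> (mp_diag x) v) \<noteq> 0" for x
  proof (rule ccontr)
    assume "\<not> r \<le> nabs x"
    then have r: "nabs x < 1" "nabs x < 1 / (nabs \<xi> * Q)" by (auto simp: r_def)
    have "(nabs x)\<^sup>2 \<le> 1 / (nabs \<xi> * Q)"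
      using r power_decreasing[of 1 2 "nabs x"] by simp
    then have small: "nabs \<xi> * (nabs x)\<^sup>2 * Q \<le> 1"
      using Q assms(4) by (simp add: field_simps)
    have "module_hom smul smul (\<pi> (mp_diag x))" "module_hom smul (*) l"
      using rep whittaker mp_diag_carrier[OF x]
      by (simp_all add: mp_rep_def whittaker_functional_def linear_iff_module_hom)
    then have L: "module_hom smul (*) (\<lambda>w. l (\<pi> (mp_diag x) w))"
      by (simp add: module_hom_iff)
    have "l (\<pi> (mp_diag x) v) = 0"
    \<comment> \<open>The linear form is constant along P^n because \<open>\<psi>\<close> is trivial
      on integers, and the integrand is invariant under P^m because \<open>v\<close> is fixed by the
      unipotents from P^m.\<close>
    proof (rule step_integral_eq_0_imp[OF haar L _ _ n])
      fix a :: 'k assume "a \<in> ideal_power n"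
      then have "nabs a \<le> Q" by (simp add: ideal_power_def Q_def)
      then have "nabs \<xi> * (nabs x)\<^sup>2 * nabs a \<le> nabs \<xi> * (nabs x)\<^sup>2 * Q"
        by (intro mult_left_mono) auto
      then have "\<xi> * (x\<^sup>2 * a) \<in> valuation_ring"
        using small by (simp add: valuation_ring_def nabs_mult nabs_power mult.assoc)
      then show "l (\<pi> (mp_diag x) (\<pi> (mp_unip a) v)) = l (\<pi> (mp_diag x) v)"
        using triv whittaker_diag_unip[OF x] by simp
    next
      fix a b :: 'k assume "b \<in> ideal_power (int m)"
      then have "\<pi> (mp_unip b) v = v"
        using m mp_unip_congruence[of b m] by (simp add: mp_unip_def)
      then show "\<pi> (mp_unip (a + b)) v = \<pi> (mp_unip a) v"
        using rep_mult[of "mp_unip a" "mp_unip b" v] by (simp add: mp_unip_carrier mp_unip_mult)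
    qed
    then show False using l by simp
  qed
  moreover have "r > 0" using Q assms(4) by (simp add: r_def)
  ultimately show ?thesis by blast
qed

text \<open>The perturbation is multiplicative, so a single \<open>e\<close> serves all
  \<open>x\<close>.\<close>

lemma whittaker_chi_locally_constant:
  assumes haar: "haar_measure dx"
  shows "\<exists>e>0. \<forall>x z. x \<noteq> 0 \<longrightarrow> nabs z < e \<longrightarrow>
    l (\<pi> (mp_diag (x * (1 + z))) v) * chi_weil dx \<psi> (x * (1 + z)) =
    l (\<pi> (mp_diag x) v) * chi_weil dx \<psi> x"
proof -
  obtain n where n: "\<forall>g\<in>congruence_subgroup n. \<pi> (g, 1) v = v"
    using smooth_fixed_congruence[OF rep smooth] by blast
  obtain d where d: "d > 0"
      "\<And>z::'k. nabs z < d \<Longrightarrow> \<exists>t. nabs t = 1 \<and> t\<^sup>2 = 1 + z"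
    using exists_sqrt_one_plus by blast
  define Q where "Q = real (residue_card TYPE('k)) powi (- int n)"
  have Q: "Q > 0" using residue_card_ge_2[where 'k='k] by (simp add: Q_def)
  \<comment> \<open>The bound \<open>d\<close> makes \<open>1 + z\<close> the square of a unit; the
    bounds 1 and \<open>Q\<close> put the diagonal element of \<open>1 + z\<close> into the
    congruence subgroup that fixes \<open>v\<close>.\<close>
  define e where "e = min d (min 1 Q)"
  have "l (\<pi> (mp_diag (x * (1 + z))) v) * chi_weil dx \<psi> (x * (1 + z)) =
      l (\<pi> (mp_diag x) v) * chi_weil dx \<psi> x" if x: "x \<noteq> 0" and z: "nabs z < e" for x z
  proof -
    have z': "nabs z < d" "nabs z < 1" "nabs z < Q" using z by (auto simp: e_def)
    obtain t where t: "nabs t = 1" "t\<^sup>2 = 1 + z" using d(2)[OF z'(1)] by blast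
    have t0: "t \<noteq> 0" using t(1) by auto
    have "z \<in> ideal_power (int n)" using z'(3) by (simp add: ideal_power_def Q_def)
    then have "\<pi> (mp_diag (1 + z)) v = v"
      using n mp_diag_congruence[OF z'(2), of n] by (simp add: mp_diag_def)
    then have "\<pi> (mp_diag (x * (1 + z))) v = \<pi> (mp_diag x) v"
      using rep_mult[OF mp_diag_carrier mp_diag_carrier, of x "t\<^sup>2" v] x t0
      by (simp add: mp_diag_mult_square flip: t(2))
    moreover have "chi_weil dx \<psi> (x * (1 + z)) = chi_weil dx \<psi> x"
      using chi_weil_unit_square[OF haar t(1), of \<psi> x] by (simp add: t(2))
    ultimately show ?thesis by simp
  qed
  moreover have "e > 0" using d(1) Q by (simp add: e_def)
  ultimately show ?thesis by blast
qed

end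


subsection \<open>Integration over an annulus\<close>

lemma continuous_on_nabs: "continuous_on A (nabs :: 'k::nonarch_valued_field \<Rightarrow> real)"
proof -
  have "continuous_on A (\<lambda>x::'k. dist x 0)"
    by (intro continuous_intros)
  then show ?thesis by (simp add: dist_nabs)
qed

lemma compact_annulus: "compact {x::'k::nonarch_local_field_char_0. r \<le> nabs x \<and> nabs x \<le> R}"
proof -
  obtain i where i: "R \<le> real (residue_card TYPE('k)) ^ i"
    using exists_residue_power_ge by blast
  have "compact (ideal_power (- int i) \<inter> {x::'k. r \<le> nabs x \<and> nabs x \<le> R})"
    using continuous_on_nabs
    by (intro compact_Int_closed compact_ideal_power closed_Collect_conj closed_Collect_le
        continuous_on_const)
  moreover have "ideal_power (- int i) \<inter> {x::'k. r \<le> nabs x \<and> nabs x \<le> R} =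
      {x. r \<le> nabs x \<and> nabs x \<le> R}"
    using i by (auto simp: ideal_power_def)
  ultimately show ?thesis by simp
qed

text \<open>Every \<open>y\<close> near \<open>x\<close> is \<open>x * (1 + z)\<close> with
  \<open>z = (y - x) / x\<close>, so the multiplicative radius \<open>e\<close> becomes the metric
  radius \<open>e * nabs x\<close>, positive away from 0.\<close>

lemma continuous_on_if_locally_constant:
  fixes h :: "'k::nonarch_local_field_char_0 \<Rightarrow> complex"
  assumes e: "e > 0"
    and h: "\<And>x z. x \<noteq> 0 \<Longrightarrow> nabs z < e \<Longrightarrow> h (x * (1 + z)) = h x"
  shows "continuous_on (- {0}) h"
proof (rule continuous_at_imp_continuous_on, rule ballI)
  fix x :: 'k assume "x \<in> - {0}"
  then have x: "x \<noteq> 0" by simp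
  have near: "h y = h x" if "dist y x < e * nabs x" for y
  proof -
    have "nabs ((y - x) / x) < e"
      using that x by (simp add: dist_nabs nabs_divide pos_divide_less_eq)
    then have "h (x * (1 + (y - x) / x)) = h x" using x by (intro h)
    then show ?thesis using x by (simp add: field_simps)
  qed
  have "e * nabs x > 0" using e x by simp
  then have "eventually (\<lambda>y. h y = h x) (nhds x)"
    unfolding eventually_nhds_metric by (intro exI[of _ "e * nabs x"] conjI allI impI near)
  then have "continuous (at x) h \<longleftrightarrow> continuous (at x) (\<lambda>_. h x)"
    by (rule isCont_cong)
  then show "isCont h x" by simp
qed

lemma sets_mult_measure: "haar_measure dx \<Longrightarrow> sets (mult_measure dx) = sets borel"
  by (simp add: mult_measure_def haar_measure_def)

text \<open>The density \<open>1 / nabs x\<close> is at most \<open>1 / r\<close> on the annulus,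
  which is compact and so has finite Haar measure.\<close>

lemma emeasure_mult_measure_annulus:
  fixes dx :: "'k::nonarch_local_field_char_0 measure"
  assumes haar: "haar_measure dx" and r: "r > 0"
  shows "emeasure (mult_measure dx) {x. r \<le> nabs x \<and> nabs x \<le> R} < \<infinity>" (is "emeasure _ ?A < _")
proof -
  have sets [measurable_cong]: "sets dx = sets borel"
    using haar by (simp add: haar_measure_def)
  have [measurable]: "(nabs :: 'k \<Rightarrow> real) \<in> borel_measurable borel"
    by (intro borel_measurable_continuous_onI continuous_on_nabs)
  have A: "?A \<in> sets dx"
    unfolding sets using compact_annulus by (intro borel_compact)
  have "emeasure (mult_measure dx) ?A = (\<integral>\<^sup>+x. ennreal (1 / nabs x) * indicator ?A x \<partial>dx)"
    unfolding mult_measure_def using A by (intro emeasure_density) measurable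
  also have "\<dots> \<le> (\<integral>\<^sup>+x. ennreal (1 / r) * indicator ?A x \<partial>dx)"
    using r by (intro nn_integral_mono) (auto simp: indicator_def intro!: ennreal_leI frac_le)
  also have "\<dots> = ennreal (1 / r) * emeasure dx ?A"
    using A by (rule nn_integral_cmult_indicator)
  also have "\<dots> < \<infinity>"
    using haar compact_annulus[of r R, where 'k='k]
    by (auto simp: haar_measure_def ennreal_mult_less_top)
  finally show ?thesis .
qed

text \<open>A continuous function is bounded on the annulus, which is compact and avoids 0, and the
  annulus has finite measure.\<close>

lemma set_integrable_annulus:
  fixes h :: "'k::nonarch_local_field_char_0 \<Rightarrow> complex"
  assumes haar: "haar_measure dx" and r: "r > 0"
    and cont: "continuous_on (- {0}) h"
    and supp: "\<And>x. x \<noteq> 0 \<Longrightarrow> h x \<noteq> 0 \<Longrightarrow> r \<le> nabs x \<and> nabs x \<le> R"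
  shows "set_integrable (mult_measure dx) (- {0}) h"
proof -
  let ?A = "{x::'k. r \<le> nabs x \<and> nabs x \<le> R}"
  have "?A \<subseteq> - {0}" using r by auto
  then have "compact (h ` ?A)"
    using compact_annulus cont by (intro compact_continuous_image) (rule continuous_on_subset)
  then have "bounded (h ` ?A)"
    by (rule compact_imp_bounded)
  then obtain B where bound: "\<forall>y\<in>h ` ?A. norm y \<le> B"
    unfolding bounded_iff ..
  have B: "norm (h x) \<le> B" if "x \<in> ?A" for x
    by (rule bspec[OF bound imageI[OF that]])
  show ?thesis
    unfolding set_integrable_def
  proof (rule integrableI_bounded_set[where A = ?A and B = B])
    show "?A \<in> sets (mult_measure dx)"
      unfolding sets_mult_measure[OF haar] using compact_annulus by (intro borel_compact)
    show "(\<lambda>x. indicator (- {0}) x *\<^sub>R h x) \<in> borel_measurable (mult_measure dx)"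
      unfolding measurable_cong_sets[OF sets_mult_measure[OF haar] refl]
      using cont by (intro borel_measurable_continuous_on_indicator) auto
    show "emeasure (mult_measure dx) ?A < \<infinity>"
      by (rule emeasure_mult_measure_annulus[OF haar r])
    show "AE x in mult_measure dx. x \<in> ?A \<longrightarrow> norm (indicator (- {0}) x *\<^sub>R h x) \<le> B"
      using \<open>?A \<subseteq> - {0}\<close> by (intro AE_I2 impI) (simp add: B subset_iff)
    show "AE x in mult_measure dx. x \<notin> ?A \<longrightarrow> indicator (- {0}) x *\<^sub>R h x = 0"
      using supp by (intro AE_I2) (auto simp: indicator_def)
  qed
qed

text \<open>For a positive real base \<open>Ln\<close> is the real logarithm, so there is no branch
  ambiguity. On the shell |x| = q^k this turns |x|^w into the k-th power of q^w.\<close>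

lemma powi_powr_of_real:
  assumes "r > 0"
  shows "complex_of_real (r powi k) powr w = (of_real r powr w) powi k"
proof -
  have "r powi k = exp (of_int k * ln r)"
    using assms exp_power_int[of "ln r" k] by simp
  then have "complex_of_real (r powi k) powr w = exp (w * (of_int k * of_real (ln r)))"
    by (simp add: powr_def Ln_of_real)
  also have "\<dots> = (of_real r powr w) powi k"
    using assms by (simp add: powr_def Ln_of_real exp_power_int ac_simps)
  finally show ?thesis .
qed

lemma integral_annulus_shells:
  fixes h :: "'k::nonarch_local_field_char_0 \<Rightarrow> complex"
  defines "q \<equiv> real (residue_card TYPE('k))"
  assumes haar: "haar_measure dx"
    and int: "set_integrable (mult_measure dx) (- {0}) h"
    and supp: "\<And>x. x \<noteq> 0 \<Longrightarrow> h x \<noteq> 0 \<Longrightarrow> nabs x \<in> (\<lambda>k. q powi k) ` {- int B..int B}"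
  shows "(LINT x : - {0}|mult_measure dx. h x) =
    (\<Sum>k\<in>{- int B..int B}. LINT x : {x. nabs x = q powi k}|mult_measure dx. h x)"
proof -
  let ?S = "\<lambda>k. {x::'k. nabs x = q powi k}"
  have q: "q > 1" using residue_card_ge_2[where 'k='k] by (simp add: q_def)
  \<comment> \<open>A shell is an annulus whose two radii coincide, hence compact.\<close>
  have sets: "?S k \<in> sets (mult_measure dx)" for k
    using borel_compact[OF compact_annulus[of "q powi k" "q powi k", where 'k='k]]
    unfolding sets_mult_measure[OF haar] by (simp add: eq_iff conj_commute)
  have inj: "i = j" if "q powi i = q powi j" for i j
    using that power_int_strict_increasing[of i j q] power_int_strict_increasing[of j i q] q
    by (cases i j rule: linorder_cases) auto
  have S0: "?S k \<subseteq> - {0}" for k using q by auto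
  have "(LINT x : - {0}|mult_measure dx. h x) =
      (LINT x : (\<Union>k\<in>{- int B..int B}. ?S k)|mult_measure dx. h x)"
    unfolding set_lebesgue_integral_def
    using supp S0 by (intro Bochner_Integration.integral_cong) (auto simp: indicator_def image_iff)
  also have "\<dots> = (\<Sum>k\<in>{- int B..int B}. LINT x : ?S k|mult_measure dx. h x)"
  proof (rule set_integral_finite_Union)
    show "disjoint_family_on ?S {- int B..int B}"
      unfolding disjoint_family_on_def
    proof (intro ballI impI)
      fix m n :: int assume "m \<noteq> n"
      then have "q powi m \<noteq> q powi n" using inj by blast
      then show "?S m \<inter> ?S n = {}" by auto
    qed
  qed (simp_all add: sets set_integrable_subset[OF int sets S0])
  finally show ?thesis .
qed

section \<open>The zeta integral as a Laurent polynomial in q^s\<close>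

theorem theorem7:
  fixes \<psi> :: "'k::nonarch_local_field_char_0 \<Rightarrow> complex"
    and dx :: "'k measure"
    and smul :: "complex \<Rightarrow> 'v::ab_group_add \<Rightarrow> 'v"
    and \<pi> :: "('k^2^2) \<times> int \<Rightarrow> 'v \<Rightarrow> 'v"
    and \<xi> :: 'k
    and l :: "'v \<Rightarrow> complex"
    and v :: 'v
    and \<mu> :: "'k \<Rightarrow> complex"
  assumes "odd (residue_card TYPE('k))"
    and "additive_character \<psi>"
    and "\<forall>x\<in>valuation_ring. \<psi> x = 1"
    and "\<exists>x\<in>ideal_power (- 1). \<psi> x \<noteq> 1"
    and "self_dual_haar_measure \<psi> dx"
    and "mp_rep smul \<pi>"
    and "mp_irreducible smul \<pi>"
    and "mp_admissible smul \<pi>"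
    and "mp_genuine \<pi>"
    and "mp_supercuspidal dx smul \<pi>"
    and "\<xi> \<in> whittaker_support \<psi> smul \<pi>"
    and "whittaker_functional \<psi> smul \<pi> \<xi> l"
    and "\<exists>w. l w \<noteq> 0"
    and "mult_character \<mu>"
  shows "(\<forall>s. set_integrable (mult_measure dx) (- {0}) (zeta_integrand dx \<psi> \<pi> s \<mu> l v)) \<and>
    (\<exists>c :: int \<Rightarrow> complex. finite {m. c m \<noteq> 0} \<and>
      (\<forall>s. zeta_integral dx \<psi> \<pi> s \<mu> l v =
        (\<Sum>m | c m \<noteq> 0. c m * (of_nat (residue_card TYPE('k)) powr s) powi m)))"
proof -
  let ?q = "real (residue_card TYPE('k))"
  let ?Q = "of_nat (residue_card TYPE('k)) :: complex"
  let ?M = "mult_measure dx"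
  let ?G = "\<lambda>s. zeta_integrand dx \<psi> \<pi> s \<mu> l v"
  have q: "?q > 1" using residue_card_ge_2[where 'k='k] by simp
  have haar: "haar_measure dx" and smooth: "mp_smooth \<pi>" and "\<xi> \<noteq> 0"
    using assms by (auto simp: self_dual_haar_measure_def mp_admissible_def whittaker_support_def)
  have \<mu>: "continuous_on (- {0}) \<mu>" using assms by (simp add: mult_character_def)
  define H where "H = (\<lambda>x. l (\<pi> (mp_diag x) v) * chi_weil dx \<psi> x)"
  obtain R where R: "\<And>x. x \<noteq> 0 \<Longrightarrow> H x \<noteq> 0 \<Longrightarrow> nabs x \<le> R"
    using whittaker_vanishes_at_infinity[OF \<open>mp_rep smul \<pi>\<close> smooth
        \<open>whittaker_functional \<psi> smul \<pi> \<xi> l\<close> \<open>\<xi> \<noteq> 0\<close>, of v] assms(4)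
    by (auto simp: H_def)
  obtain r where r: "r > 0" "\<And>x. x \<noteq> 0 \<Longrightarrow> H x \<noteq> 0 \<Longrightarrow> r \<le> nabs x"
    using whittaker_vanishes_at_zero[OF \<open>mp_rep smul \<pi>\<close> smooth
        \<open>whittaker_functional \<psi> smul \<pi> \<xi> l\<close> haar assms(3,10) \<open>\<xi> \<noteq> 0\<close>, of v]
    by (auto simp: H_def)
  obtain e where e: "e > 0" "\<And>x z. x \<noteq> 0 \<Longrightarrow> nabs z < e \<Longrightarrow> H (x * (1 + z)) = H x"
    using whittaker_chi_locally_constant[OF \<open>mp_rep smul \<pi>\<close> smooth
        \<open>whittaker_functional \<psi> smul \<pi> \<xi> l\<close> haar, of v] unfolding H_def by blast
  have H: "continuous_on (- {0}) H" by (rule continuous_on_if_locally_constant[OF e])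
  have G: "?G s = (\<lambda>x. H x * \<mu> x * of_real (nabs x) powr (s - 1 / 2))" for s
    by (simp add: fun_eq_iff zeta_integrand_def H_def)
  \<comment> \<open>Away from 0 the base \<open>nabs x\<close> is a positive real, off the branch
    cut of \<open>powr\<close>.\<close>
  have G_cont: "continuous_on (- {0}) (?G s)" for s
    unfolding G
    by (intro continuous_on_mult H \<mu> continuous_on_powr_complex continuous_on_of_real
        continuous_on_nabs continuous_on_const) (auto simp: complex_nonpos_Reals_iff)
  have int: "set_integrable ?M (- {0}) (?G s)" for s
    using r R by (intro set_integrable_annulus[OF haar r(1) G_cont, where R=R]) (auto simp: G)
  obtain i j where i: "R \<le> ?q ^ i" and j: "?q powi (- int j) \<le> r"
    using exists_residue_power_ge exists_residue_power_le[OF r(1)] by metis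
  \<comment> \<open>A symmetric range of exponents that contains both \<open>- int j\<close> and
    \<open>int i\<close>.\<close>
  define B where "B = max i j"
  have shells: "nabs x \<in> (\<lambda>k. ?q powi k) ` {- int B..int B}" if x: "x \<noteq> 0" and Hx: "H x \<noteq> 0" for x
  proof -
    obtain k where k: "nabs x = ?q powi k" using nabs_value[OF x] by blast
    have "?q powi k \<le> ?q powi int i" "?q powi (- int j) \<le> ?q powi k"
      using R[OF x Hx] r(2)[OF x Hx] i j k by simp_all
    then have "k \<le> int i" "- int j \<le> k"
      using q power_int_strict_increasing[of "int i" k ?q]
        power_int_strict_increasing[of k "- int j" ?q] by (force simp: not_le[symmetric])+
    then have "k \<in> {- int B..int B}" by (auto simp: B_def)
    then show ?thesis unfolding k by (rule imageI)
  qed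
  \<comment> \<open>Collects the factor 2, the factor q^(-k/2) from the shift in
    \<open>s - 1 / 2\<close>, and the shell integral of the part free of \<open>s\<close>. The value
    0 outside the range gives finite support.\<close>
  define c where "c k = (if k \<in> {- int B..int B} then
    2 * (?Q powr (- 1 / 2)) powi k * (LINT x : {x. nabs x = ?q powi k}|?M. H x * \<mu> x) else 0)" for k
  have shell: "2 * (LINT x : {x. nabs x = ?q powi k}|?M. ?G s x) = c k * (?Q powr s) powi k"
    if k: "k \<in> {- int B..int B}" for s k
  proof -
    let ?S = "{x::'k. nabs x = ?q powi k}"
    have "?S \<in> sets ?M"
      using borel_compact[OF compact_annulus[of "?q powi k" "?q powi k", where 'k='k]]
      unfolding sets_mult_measure[OF haar] by (simp add: eq_iff conj_commute)
    moreover have "?G s x = (?Q powr (s - 1 / 2)) powi k * (H x * \<mu> x)" if "x \<in> ?S" for x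
      using that q powi_powr_of_real[of ?q k "s - 1 / 2"] by (simp add: G)
    ultimately have "(LINT x : ?S|?M. ?G s x) =
        (LINT x : ?S|?M. (?Q powr (s - 1 / 2)) powi k * (H x * \<mu> x))"
      by (intro set_lebesgue_integral_cong) auto
    also have "\<dots> = (?Q powr (s - 1 / 2)) powi k * (LINT x : ?S|?M. H x * \<mu> x)"
      by simp
    also have "?Q powr (s - 1 / 2) = ?Q powr (- 1 / 2) * ?Q powr s"
      by (simp flip: powr_add)
    finally show ?thesis using k by (simp add: c_def power_int_mult_distrib)
  qed
  have c_supp: "{m. c m \<noteq> 0} \<subseteq> {- int B..int B}" by (auto simp: c_def)
  have "zeta_integral dx \<psi> \<pi> s \<mu> l v = (\<Sum>m | c m \<noteq> 0. c m * (?Q powr s) powi m)" for s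
  proof -
    have "(LINT x : - {0}|?M. ?G s x) =
        (\<Sum>k\<in>{- int B..int B}. LINT x : {x. nabs x = ?q powi k}|?M. ?G s x)"
      using shells by (intro integral_annulus_shells[OF haar int]) (auto simp: G)
    then have "zeta_integral dx \<psi> \<pi> s \<mu> l v = (\<Sum>k\<in>{- int B..int B}. c k * (?Q powr s) powi k)"
      unfolding zeta_integral_def by (simp only: sum_distrib_left shell cong: sum.cong)
    also have "\<dots> = (\<Sum>m | c m \<noteq> 0. c m * (?Q powr s) powi m)"
      using c_supp by (intro sum.mono_neutral_right) auto
    finally show ?thesis .
  qed
  moreover have "finite {m. c m \<noteq> 0}"
    using c_supp finite_subset by blast
  ultimately show ?thesis using int by blast
qed

end
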